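(* Let $A=(a_{ij})\in\mathbb{R}_{\max}^{n\times n}$ be symmetric, i.e. $a_{ij}=a_{ji}$ for all $i,j$. Let $\lambda\neq\mu$ be two distinct algebraic eigenvalues of $A$ (in $\mathbb{R}_{\max}$), and let $\bm{x}\in W(A,\lambda)\setminus\{\mathcal{E}\}$ and $\bm{y}\in W(A,\mu)\setminus\{\mathcal{E}\}$ be algebraic eigenvectors of $A$ with respect to $\lambda$ and $\mu$, respectively. Then $\bm{x}$ and $\bm{y}$ are orthogonal to each other, i.e. the maximum in ${}^t\!\bm{x}\otimes\bm{y}=\bigoplus_{i=1}^n x_i\otimes y_i$ is attained by at least two indices $i$.
   Context: Max-plus algebra: $\mathbb{R}_{\max}=\mathbb{R}\cup\{\varepsilon\}$, $\varepsilon=-\infty$, $a\oplus b=\max\{a,b\}$, $a\otimes b=a+b$, $e=0$; operations extend to vectors and matrices as usual. $\mathcal{E}$ is the vector with all entries $\varepsilon$; $E_n$ is the max-plus unit matrix (diagonal $0$, off-diagonal $\varepsilon$). $\det A=\bigoplus_{\pi\in S_n}\bigotimes_i a_{i\pi(i)}$. The characteristic polynomial is $\chi_A(t)=\det(A\oplus t\otimes E_n)$; as a function on $\mathbb{R}_{\max}$ it factorizes as $\bigotimes_i (t\oplus r_i)^{\otimes p_i}$ with distinct $r_i\in\mathbb{R}_{\max}$, $p_i\ge1$, $\sum p_i=n$; the roots $r_i$ are called the algebraic eigenvalues of $A$. The sum of subspaces $U_k$ of $\mathbb{R}_{\max}^n$ is $\bigoplus_k U_k=\{\bigoplus_k \bm{x}_k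 : \bm{x}_k\in U_k\}$. Graphs: $G(A)$ is the weighted digraph on $\{1,\dots,n\}$ with an edge $(i,j)$ of weight $a_{ij}$ whenever $a_{ij}\ne\varepsilon$. A multi-circuit is a (possibly empty) union of disjoint elementary circuits (loops allowed), with length $\ell$ (number of edges) and weight $w$ (sum of edge weights); $V(\mathcal{C})$, $E(\mathcal{C})$ are its vertex and edge sets. For $\lambda\in\mathbb{R}$, $\mathcal{C}$ is $\lambda$-maximal if $\chi_A(\lambda)=w(\mathcal{C})\otimes\lambda^{\otimes(n-\ell(\mathcal{C}))}$; it is $\varepsilon$-maximal if it is $\mu$-maximal for all sufficiently small (very negative) real $\mu$. For a multi-circuit $\mathcal{C}$: $A_{\mathcal{C}}$ has entry $a_{ij}$ if $(i,j)\in E(\mathcal{C})$ and $\varepsilon$ otherwise; $A_{\setminus\mathcal{C}}$ has entry $\varepsilon$ if $(i,j)\in E(\mathcal{C})$ and $a_{ij}$ otherwise; $E_{\mathcal{C}}$ (resp. $E_{\setminus\mathcal{C}}$) has $(i,i)$ entry $e$ for $i\in V(\mathcal{C})$ (resp. $i\notin V(\mathcal{C})$) and all other entries $\varepsilon$. $W(A,\lambda,\mathcal{C})$ is the set of $\bm{x}\in\mathbb{R}_{\max}^n$ with $(A_{\setminus\mathcal{C}}\oplus\lambda\otimes E_{\mathcal{C}})\otimes\bm{x}=(A_{\mathcal{C}}\oplus\lambda\otimes E_{\setminus\mathcal{C}})\otimes\bm{x}$. Algebraic eigenspace: a matrix satisfies $(\bigstar)$ if for each $\lambda\in\mathbb{R}_{\max}$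 any two distinct $\lambda$-maximal multi-circuits in its graph have different lengths. For $\bm{\zeta}=(\zeta_{ij})\in[0,1]^{n\times n}$ and $\delta>0$ let $[A(\bm{\zeta};\delta)]_{ij}=a_{ij}-\zeta_{ij}\delta$. Let $Z$ be the (nonempty) set of $\bm{\zeta}\in[0,1]^{n\times n}$ for which there is $\delta'>0$ such that $A(\bm{\zeta};\delta)$ satisfies $(\bigstar)$ for all $0<\delta<\delta'$. Let $\mathcal{B}(\lambda,r)=[\lambda-r,\lambda+r]$ for $\lambda\in\mathbb{R}$ and $\mathcal{B}(\varepsilon,r)=\{\varepsilon\}$. The algebraic eigenspace of $A$ with respect to $\lambda$ is $$W(A,\lambda)=\bigcap_{\bm{\zeta}\in Z}\lim_{\delta\to+0}\bigoplus_{\lambda'\in\mathcal{B}(\lambda,n\delta)}W(A(\bm{\zeta};\delta),\lambda',\mathcal{C}_{\lambda'}(\bm{\zeta};\delta)),$$ where $\mathcal{C}_{\lambda'}(\bm{\zeta};\delta)$ is any $\lambda'$-maximal multi-circuit in $G(A(\bm{\zeta};\delta))$ (for small $\delta$ the space does not depend on this choice, and only finitely many $\lambda'$, the roots of $\chi_{A(\bm{\zeta};\delta)}$, give a space other than $\{\mathcal{E}\}$, so the sum is finite). Here $\lim_{\delta\to+0}S(\delta)$ is the set of $\bm{x}\in\mathbb{R}_{\max}^n$ for which there are $\bm{x}(\delta)\in S(\delta)$ with $\lim_{\delta\to+0}\bm{x}(\delta)=\bm{x}$ (usual topology of $\mathbb{R}\cup\{-\infty\}$). Nontrivial vectors of $W(A,\lambda)$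 are the algebraic eigenvectors of $A$ with respect to $\lambda$. *)

theory Defs
  imports "HOL-Analysis.Analysis" "Graph_Theory.Pair_Digraph"
begin

text \<open>
  The max-plus semiring is carried by the extended reals other than \<open>\<infinity>\<close>: the zero element
  is \<open>-\<infinity>\<close>, addition is \<open>max\<close>, multiplication is \<open>+\<close>, and the topology is the one induced
  from \<^typ>\<open>ereal\<close>.  The functions below are meant for arguments in this carrier only.
  The dimension is \<open>CARD('n)\<close>, and the vertex set of the graph of a matrix is the type \<open>'n\<close>.
\<close>

definition rmax :: "ereal set" where
  "rmax = {a. a \<noteq> \<infinity>}"

definition rmax_vec :: "(ereal ^ 'n) set" where
  "rmax_vec = {x. \<forall>i. x $ i \<in> rmax}"

definition rmax_mat :: "(ereal ^ 'n ^ 'n) set" where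
  "rmax_mat = {A. \<forall>i j. A $ i $ j \<in> rmax}"

definition mp_zero_vec :: "ereal ^ 'n" where
  "mp_zero_vec = (\<chi> i. -\<infinity>)"

definition mp_power :: "ereal \<Rightarrow> nat \<Rightarrow> ereal" where
  "mp_power a k = ereal (real k) * a"

definition mp_unit_mat :: "ereal ^ 'n ^ 'n" where
  "mp_unit_mat = (\<chi> i j. if i = j then 0 else -\<infinity>)"

definition mp_mat_add :: "ereal ^ 'n ^ 'n \<Rightarrow> ereal ^ 'n ^ 'n \<Rightarrow> ereal ^ 'n ^ 'n" where
  "mp_mat_add A B = (\<chi> i j. max (A $ i $ j) (B $ i $ j))"

definition mp_mat_scale :: "ereal \<Rightarrow> ereal ^ 'n ^ 'n \<Rightarrow> ereal ^ 'n ^ 'n" where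
  "mp_mat_scale t A = (\<chi> i j. t + A $ i $ j)"

definition mp_mat_vec :: "ereal ^ 'n ^ 'n \<Rightarrow> ereal ^ 'n \<Rightarrow> ereal ^ ('n::finite)" where
  "mp_mat_vec A x = (\<chi> i. MAX j. A $ i $ j + x $ j)"

definition mp_inner :: "ereal ^ 'n \<Rightarrow> ereal ^ ('n::finite) \<Rightarrow> ereal" where
  "mp_inner x y = (MAX i. x $ i + y $ i)"

text \<open>
  Orthogonality is literally ``the maximum is attained at least twice''; in particular, if all
  products are \<open>-\<infinity>\<close>, the maximum is attained at every index.
\<close>

definition mp_orthogonal :: "ereal ^ 'n \<Rightarrow> ereal ^ ('n::finite) \<Rightarrow> bool" where
  "mp_orthogonal x y \<longleftrightarrow>
     (\<exists>i j. i \<noteq> j \<and> x $ i + y $ i = mp_inner x y \<and> x $ j + y $ j = mp_inner x y)"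

definition mp_det :: "ereal ^ 'n ^ 'n \<Rightarrow> ereal" where
  "mp_det A = (MAX p\<in>{p. p permutes (UNIV :: 'n::finite set)}. \<Sum>i\<in>UNIV. A $ i $ p i)"

definition mp_charpoly :: "ereal ^ 'n ^ 'n \<Rightarrow> ereal \<Rightarrow> ereal" where
  "mp_charpoly A t = mp_det (mp_mat_add A (mp_mat_scale t (mp_unit_mat :: ereal ^ 'n ^ 'n::finite)))"

text \<open>
  The algebraic eigenvalues are the roots in the factorization of the polynomial function
  into max-plus linear factors: \<open>R\<close> is the set of distinct roots and \<open>p\<close> gives multiplicities.
\<close>

definition algebraic_eigenvalue :: "ereal ^ 'n ^ 'n \<Rightarrow> ereal \<Rightarrow> bool" where
  "algebraic_eigenvalue A r \<longleftrightarrow>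
     (\<exists>R p. finite R \<and> R \<subseteq> rmax \<and> (\<forall>s\<in>R. p s \<ge> 1) \<and> (\<Sum>s\<in>R. p s) = CARD('n::finite) \<and>
        (\<forall>t\<in>rmax. mp_charpoly (A :: ereal ^ 'n ^ 'n) t = (\<Sum>s\<in>R. mp_power (max t s) (p s))) \<and>
        r \<in> R)"

text \<open>
  The weight of the edge \<open>(i, j)\<close> of the graph is the entry \<open>A $ i $ j\<close>.  Multi-circuits are
  represented by their edge sets.  Since every vertex of a multi-circuit lies on one of its
  edges, the vertex set is the field of the edge set.
\<close>

definition mp_graph :: "ereal ^ 'n ^ 'n \<Rightarrow> 'n pair_pre_digraph" where
  "mp_graph A = \<lparr> pverts = UNIV, parcs = {(i, j). A $ i $ j \<noteq> -\<infinity>} \<rparr>"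

definition elementary_circuit :: "ereal ^ 'n ^ 'n \<Rightarrow> 'n rel \<Rightarrow> bool" where
  "elementary_circuit A c \<longleftrightarrow> (\<exists>p. pre_digraph.cycle (with_proj (mp_graph A)) p \<and> c = set p)"

definition multi_circuit :: "ereal ^ 'n ^ 'n \<Rightarrow> 'n rel \<Rightarrow> bool" where
  "multi_circuit A C \<longleftrightarrow>
     (\<exists>F. (\<forall>c\<in>F. elementary_circuit A c) \<and> pairwise (\<lambda>c d. Field c \<inter> Field d = {}) F \<and> C = \<Union>F)"

definition mc_weight :: "ereal ^ 'n ^ 'n \<Rightarrow> 'n rel \<Rightarrow> ereal" where
  "mc_weight A C = (\<Sum>(i, j)\<in>C. A $ i $ j)"

definition mc_attains :: "ereal ^ 'n ^ 'n \<Rightarrow> real \<Rightarrow> 'n::finite rel \<Rightarrow> bool" where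
  "mc_attains A t C \<longleftrightarrow>
     mp_charpoly A (ereal t) = mc_weight A C + mp_power (ereal t) (CARD('n) - card C)"

definition maximal_multi_circuit :: "ereal ^ 'n ^ 'n \<Rightarrow> ereal \<Rightarrow> 'n::finite rel \<Rightarrow> bool" where
  "maximal_multi_circuit A l C \<longleftrightarrow> multi_circuit A C \<and>
     (if l = -\<infinity> then (\<forall>\<^sub>F t in at_bot. mc_attains A t C) else mc_attains A (real_of_ereal l) C)"

definition mat_on :: "ereal ^ 'n ^ 'n \<Rightarrow> 'n rel \<Rightarrow> ereal ^ 'n ^ 'n" where
  "mat_on A C = (\<chi> i j. if (i, j) \<in> C then A $ i $ j else -\<infinity>)"

definition mat_off :: "ereal ^ 'n ^ 'n \<Rightarrow> 'n rel \<Rightarrow> ereal ^ 'n ^ 'n" where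
  "mat_off A C = (\<chi> i j. if (i, j) \<in> C then -\<infinity> else A $ i $ j)"

definition unit_on :: "'n rel \<Rightarrow> ereal ^ 'n ^ 'n" where
  "unit_on C = (\<chi> i j. if i = j \<and> i \<in> Field C then 0 else -\<infinity>)"

definition unit_off :: "'n rel \<Rightarrow> ereal ^ 'n ^ 'n" where
  "unit_off C = (\<chi> i j. if i = j \<and> i \<notin> Field C then 0 else -\<infinity>)"

definition circuit_space :: "ereal ^ 'n ^ 'n \<Rightarrow> ereal \<Rightarrow> 'n rel \<Rightarrow> (ereal ^ ('n::finite)) set" where
  "circuit_space A l C = {x \<in> rmax_vec.
     mp_mat_vec (mp_mat_add (mat_off A C) (mp_mat_scale l (unit_on C))) x =
     mp_mat_vec (mp_mat_add (mat_on A C) (mp_mat_scale l (unit_off C))) x}"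

definition star_condition :: "ereal ^ 'n ^ 'n::finite \<Rightarrow> bool" where
  "star_condition A \<longleftrightarrow> (\<forall>l\<in>rmax. \<forall>C D.
     maximal_multi_circuit A l C \<and> maximal_multi_circuit A l D \<and> C \<noteq> D \<longrightarrow> card C \<noteq> card D)"

definition perturb :: "ereal ^ 'n ^ 'n \<Rightarrow> real ^ 'n ^ 'n \<Rightarrow> real \<Rightarrow> ereal ^ 'n ^ 'n" where
  "perturb A z d = (\<chi> i j. A $ i $ j - ereal (z $ i $ j * d))"

definition good_directions :: "ereal ^ 'n ^ 'n::finite \<Rightarrow> (real ^ 'n ^ 'n) set" where
  "good_directions A = {z. (\<forall>i j. z $ i $ j \<in> {0..1}) \<and>
     (\<exists>d'>0. \<forall>d. 0 < d \<and> d < d' \<longrightarrow> star_condition (perturb A z d))}"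

definition mp_ball :: "ereal \<Rightarrow> real \<Rightarrow> ereal set" where
  "mp_ball l r = (if l = -\<infinity> then {-\<infinity>} else {l - ereal r .. l + ereal r})"

text \<open>
  The sum of a family of subspaces.  For an infinite index set only families with finitely many
  nontrivial members are summed, so that the sum stays in the carrier.
\<close>

definition mp_subspace_sum :: "'k set \<Rightarrow> ('k \<Rightarrow> (ereal ^ 'n) set) \<Rightarrow> (ereal ^ 'n) set" where
  "mp_subspace_sum K U = {\<chi> i. SUP k\<in>K. f k $ i | f.
     (\<forall>k\<in>K. f k \<in> U k) \<and> finite {k \<in> K. f k \<noteq> mp_zero_vec}}"

text \<open>
  Only small \<open>d\<close> matter.  The sets to which this is applied contain the zero vector for
  every \<open>d\<close>, so requiring \<open>f d \<in> S d\<close> eventually or for all \<open>d > 0\<close> gives the same limit.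
\<close>

definition mp_lim_set :: "(real \<Rightarrow> (ereal ^ 'n) set) \<Rightarrow> (ereal ^ 'n) set" where
  "mp_lim_set S = {x \<in> rmax_vec.
     \<exists>f. (\<forall>\<^sub>F d in at_right 0. f d \<in> S d) \<and> (f \<longlongrightarrow> x) (at_right 0)}"

text \<open>
  The space \<^const>\<open>circuit_space\<close> is taken for an arbitrary maximal multi-circuit, chosen by
  \<open>SOME\<close>; for small \<open>d\<close> it does not depend on the choice.
\<close>

definition algebraic_eigenspace :: "ereal ^ 'n ^ 'n \<Rightarrow> ereal \<Rightarrow> (ereal ^ ('n::finite)) set" where
  "algebraic_eigenspace A l = (\<Inter>z\<in>good_directions A. mp_lim_set (\<lambda>d.
     mp_subspace_sum (mp_ball l (real CARD('n) * d))
       (\<lambda>l'. circuit_space (perturb A z d) l' (SOME C. maximal_multi_circuit (perturb A z d) l' C))))"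

end

theory Submission
  imports Defs
begin

text \<open>
  Over a field, eigenvectors of a symmetric matrix for different eigenvalues are orthogonal because one of
  them may be read as a left eigenvector.  The same idea works here, although the perturbations
  that define the algebraic eigenspaces destroy the symmetry: a circuit of length at least three and
  its reverse have the same weight in a symmetric matrix, so good directions are in general not
  symmetric.  But an algebraic eigenvector is a limit along every good direction.  Choose a direction
  \<open>z\<close> such that both \<open>z\<close> and its transpose are good, and approximate \<open>x\<close> along \<open>z\<close> and \<open>y\<close> along the
  transpose.  Since \<open>A\<close> is symmetric, the two perturbed matrices are transposes of each other, so \<open>x\<close> and
  \<open>y\<close> are limits of sums of right and left vectors of the same matrix \<open>B\<close>, which satisfies, like its transpose, the
  star condition, for eigenvalues near \<open>l\<close> and near \<open>m\<close>.  Orthogonality survives sums and limits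
  (\<open>no_strict_maximum_SUP\<close>, \<open>no_strict_maximum_limit\<close>), so it suffices to treat a right vector of \<open>B\<close>
  for \<open>k\<close> and a left vector of \<open>B\<close> for \<open>k' \<noteq> k\<close>.
  
  This is \<open>no_strict_maximum_circuit_spaces\<close>.  Instead of comparing \<open>y B x\<close> with \<open>k y x\<close> and \<open>k' y x\<close>, one
  looks at the positions where the products forming \<open>y B x\<close> are maximal.  If the maximum in \<open>y x\<close> were
  attained only once, the equations for the two vectors would give each row and column
  of this set of positions, with at most one exception, an edge of a maximal multi-circuit and
  a further position.  An alternating cycle then changes a maximal multi-circuit into another one with the
  same weight and length (\<open>star_condition_no_alternating_cycle\<close>), contrary to the star condition.
\<close>

section \<open>Multi-circuits as partial permutations\<close>

definition partial_permutation :: "'a rel \<Rightarrow> bool" where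
  "partial_permutation C \<longleftrightarrow> single_valued C \<and> single_valued (C\<inverse>) \<and> Domain C = Range C"

lemma partial_permutation_Field:
  "partial_permutation C \<Longrightarrow> Field C = Domain C"
  by (simp add: partial_permutation_def Field_def)

lemma pcas_iff: "pcas u p v \<longleftrightarrow> map fst p @ [v] = u # map snd p"
  by (induction p arbitrary: u) auto

lemma tl_pawalk_verts: "pcas u p v \<Longrightarrow> tl (pawalk_verts u p) = map snd p"
proof -
  have *: "pawalk_verts u p = map fst p @ [v]" if "pcas u p v" for u :: 'a
    using that by (induction p arbitrary: u) auto
  assume "pcas u p v"
  thus ?thesis using * pcas_iff[of u p v] by simp
qed

lemma elementary_circuit_iff:
  fixes A :: "ereal ^ 'n ^ 'n"
  shows "elementary_circuit A c \<longleftrightarrow>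
    (\<exists>u p. p \<noteq> [] \<and> c = set p \<and> map fst p @ [u] = u # map snd p \<and> distinct (map snd p) \<and>
       (\<forall>(i, j)\<in>set p. A $ i $ j \<noteq> -\<infinity>))"
proof -
  have "pre_digraph.cycle (with_proj (mp_graph A)) p \<longleftrightarrow>
    (\<exists>u. p \<noteq> [] \<and> map fst p @ [u] = u # map snd p \<and> distinct (map snd p) \<and>
       (\<forall>(i, j)\<in>set p. A $ i $ j \<noteq> -\<infinity>))" for p
    unfolding pre_digraph.cycle_def pre_digraph.awalk_def cas_with_proj_eq awalk_verts_with_proj_eq
      pcas_iff[symmetric]
    by (auto simp: mp_graph_def tl_pawalk_verts)
  thus ?thesis unfolding elementary_circuit_def by blast
qed

lemma elementary_circuit_partial_permutation:
  assumes "elementary_circuit A c"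
  shows "partial_permutation c" and "(i, j) \<in> c \<Longrightarrow> A $ i $ j \<noteq> -\<infinity>"
proof -
  obtain u p where p: "c = set p" "map fst p @ [u] = u # map snd p" "distinct (map snd p)"
      "\<forall>(i, j)\<in>set p. A $ i $ j \<noteq> -\<infinity>"
    using assms elementary_circuit_iff by blast
  have "mset (map fst p @ [u]) = mset (u # map snd p)" using p(2) by simp
  hence m: "mset (map fst p) = mset (map snd p)" by simp
  hence d: "distinct (map fst p)" using p(3) mset_eq_imp_distinct_iff by blast
  have "set (map fst p) = set (map snd p)" using m by (rule mset_eq_setD)
  hence DR: "Domain c = Range c" unfolding p(1) by (simp add: Domain_fst Range_snd)
  have "inj_on fst c" "inj_on snd c" using d p(3) unfolding p(1) by (auto simp: distinct_map)
  hence "single_valued c" "single_valued (c\<inverse>)"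
    by (fastforce simp: single_valued_def inj_on_def)+
  thus "partial_permutation c" using DR by (simp add: partial_permutation_def)
  show "(i, j) \<in> c \<Longrightarrow> A $ i $ j \<noteq> -\<infinity>" using p by auto
qed

lemma partial_permutation_Union:
  assumes "\<And>c. c \<in> F \<Longrightarrow> partial_permutation c"
    and "pairwise (\<lambda>c d. Field c \<inter> Field d = {}) F"
  shows "partial_permutation (\<Union>F)"
proof -
  have same: "c = d" if "c \<in> F" "d \<in> F" "a \<in> Field c" "a \<in> Field d" for a c d
    using assms(2) that unfolding pairwise_def by blast
  have fwd: "b = b'" if e: "(a, b) \<in> c" "(a, b') \<in> d" and cd: "c \<in> F" "d \<in> F" for a b b' c d
  proof -
    have "c = d" using same[OF cd] e by (auto intro: FieldI1)
    moreover have "single_valued c" using assms(1)[OF cd(1)] by (simp add: partial_permutation_def)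
    ultimately show ?thesis using e by (auto dest: single_valuedD)
  qed
  have bwd: "a = a'" if e: "(a, b) \<in> c" "(a', b) \<in> d" and cd: "c \<in> F" "d \<in> F" for a a' b c d
  proof -
    have "c = d" using same[OF cd] e by (auto intro: FieldI2)
    moreover have "single_valued (c\<inverse>)" using assms(1)[OF cd(1)] by (simp add: partial_permutation_def)
    ultimately show ?thesis using e by (auto dest: single_valuedD)
  qed
  have "single_valued (\<Union>F)" using fwd by (auto intro!: single_valuedI)
  moreover have "single_valued ((\<Union>F)\<inverse>)" using bwd by (auto intro!: single_valuedI)
  moreover have "Domain (\<Union>F) = Range (\<Union>F)"
    using assms(1) by (simp add: partial_permutation_def Domain_Union Range_Union)
  ultimately show ?thesis by (simp add: partial_permutation_def)
qed

lemma partial_permutation_extend: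
  fixes C :: "'a::finite rel"
  assumes "partial_permutation C"
  obtains s where "s permutes Domain C" and "C = (\<lambda>i. (i, s i)) ` Domain C"
proof -
  define s where "s i = (if i \<in> Domain C then THE j. (i, j) \<in> C else i)" for i
  have s: "s i = j" if "(i, j) \<in> C" for i j
    using that assms unfolding s_def partial_permutation_def single_valued_def
    by (auto intro!: the_equality)
  have C: "C = (\<lambda>i. (i, s i)) ` Domain C"
    using s by force
  have "inj_on s (Domain C)"
    using assms s unfolding inj_on_def partial_permutation_def single_valued_def by fastforce
  moreover have "s ` Domain C = Domain C"
  proof -
    have "s ` Domain C = Range C" using s by force
    thus ?thesis using assms by (simp add: partial_permutation_def)
  qed
  ultimately have "s permutes Domain C"
    by (intro bij_imp_permutes) (auto simp: bij_betw_def s_def)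
  thus ?thesis using C that by blast
qed

text \<open>
  Following the permutation that extends \<open>C\<close> from a vertex of \<open>C\<close> until the first return to
  that vertex traces out a circuit: an earlier repetition would, by injectivity, already be a
  return to the start.
\<close>

lemma partial_permutation_contains_circuit:
  fixes A :: "ereal ^ 'n ^ 'n::finite"
  assumes C: "partial_permutation C" "C \<noteq> {}" and ne: "\<And>i j. (i, j) \<in> C \<Longrightarrow> A $ i $ j \<noteq> -\<infinity>"
  obtains c where "elementary_circuit A c" "c \<subseteq> C" "c \<noteq> {}"
proof -
  obtain s where s: "s permutes Domain C" and Cs: "C = (\<lambda>i. (i, s i)) ` Domain C"
    using partial_permutation_extend[OF C(1)] .
  obtain v where v: "v \<in> Domain C" using C(2) by auto
  define it where "it k = (s ^^ k) v" for k
  have inD: "it k \<in> Domain C" for k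
    by (induction k) (auto simp: it_def v permutes_in_image[OF s])
  have edge: "(it k, it (Suc k)) \<in> C" for k
    using inD[of k] by (subst Cs) (auto simp: it_def)
  have "permutation s" unfolding permutation_permutes using s finite by blast
  then obtain n where "(s ^^ n) v = v" "n > 0" by (rule permutation_self)
  hence ex: "n > 0 \<and> it n = v" by (simp add: it_def)
  define k where "k = (LEAST k. k > 0 \<and> it k = v)"
  have k: "k > 0" "it k = v" using LeastI[of "\<lambda>k. k > 0 \<and> it k = v", OF ex] by (auto simp: k_def)
  have least: "\<not> (0 < i \<and> it i = v)" if "i < k" for i
    using not_less_Least[of i "\<lambda>k. k > 0 \<and> it k = v"] that by (auto simp: k_def)
  have "inj (s ^^ i)" for i using permutes_inj[OF s] by (rule inj_fn)
  hence shift: "it (j - i) = v" if "i \<le> j" "it i = it j" for i j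
  proof -
    have "(s ^^ i) (it (j - i)) = (s ^^ i) v"
      using that by (simp add: it_def flip: funpow_add comp_apply[of "s ^^ i" "s ^^ (j - i)"])
    thus ?thesis using \<open>\<And>i. inj (s ^^ i)\<close> by (meson injD)
  qed
  have inj: "inj_on it {0..<k}"
  proof (rule linorder_inj_onI)
    fix i j assume "i < j" "i \<in> {0..<k}" "j \<in> {0..<k}"
    thus "it i \<noteq> it j" using least[of "j - i"] shift[of i j] by auto
  qed auto
  define p where "p = map (\<lambda>i. (it i, it (Suc i))) [0..<k]"
  have fst: "map fst p = map it [0..<k]" by (simp add: p_def comp_def)
  have snd: "map snd p = map it [Suc 0..<Suc k]"
    unfolding map_Suc_upt[symmetric] p_def by (simp add: comp_def del: upt_Suc)
  have "v # map snd p = map it (0 # [Suc 0..<Suc k])" by (simp add: snd it_def)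
  also have "\<dots> = map it [0..<Suc k]" using upt_conv_Cons[of 0 "Suc k"] by simp
  also have "\<dots> = map fst p @ [v]" using k by (simp add: fst)
  finally have walk: "map fst p @ [v] = v # map snd p" by simp
  have "mset (map fst p @ [v]) = mset (v # map snd p)" using walk by simp
  hence m: "mset (map fst p) = mset (map snd p)" by simp
  have "distinct (map fst p)" using inj by (simp add: fst distinct_map)
  hence "distinct (map snd p)" using m mset_eq_imp_distinct_iff by blast
  moreover have "p \<noteq> []" using k by (simp add: p_def)
  moreover have sub: "set p \<subseteq> C" using edge by (auto simp: p_def)
  ultimately have "elementary_circuit A (set p)"
    unfolding elementary_circuit_iff using walk ne by blast
  thus ?thesis using that sub \<open>p \<noteq> []\<close> by auto
qed

text \<open>
  This is the cycle decomposition of a permutation.  It lets the exchange argument below deal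
  with relations only: whether a set of edges is a multi-circuit depends on its in- and out-degrees,
  not on how the edges are strung together.
\<close>

lemma multi_circuit_iff:
  fixes A :: "ereal ^ 'n ^ 'n::finite"
  shows "multi_circuit A C \<longleftrightarrow> partial_permutation C \<and> (\<forall>(i, j)\<in>C. A $ i $ j \<noteq> -\<infinity>)"
proof
  assume "multi_circuit A C"
  then obtain F where F: "\<And>c. c \<in> F \<Longrightarrow> elementary_circuit A c"
    "pairwise (\<lambda>c d. Field c \<inter> Field d = {}) F" "C = \<Union>F"
    unfolding multi_circuit_def by blast
  show "partial_permutation C \<and> (\<forall>(i, j)\<in>C. A $ i $ j \<noteq> -\<infinity>)"
    using partial_permutation_Union[OF _ F(2)] elementary_circuit_partial_permutation[OF F(1)] F(3)
    by auto
next
  assume "partial_permutation C \<and> (\<forall>(i, j)\<in>C. A $ i $ j \<noteq> -\<infinity>)"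
  with finite[of C] show "multi_circuit A C"
  proof (induction C rule: finite_psubset_induct)
    case (psubset C)
    show ?case
    proof (cases "C = {}")
      case True
      show ?thesis unfolding multi_circuit_def by (rule exI[of _ "{}"]) (simp add: True)
    next
      case False
      then obtain c where c: "elementary_circuit A c" "c \<subseteq> C" "c \<noteq> {}"
        using partial_permutation_contains_circuit[of C A] psubset.prems by blast
      note pc = elementary_circuit_partial_permutation(1)[OF c(1)]
      have ends: "e \<in> c" if "e \<in> C" "fst e \<in> Field c \<or> snd e \<in> Field c" for e
      proof -
        have "fst e \<in> Domain c \<or> snd e \<in> Range c"
          using that(2) pc partial_permutation_Field[OF pc] by (auto simp: partial_permutation_def)
        then consider b where "(fst e, b) \<in> c" | a where "(a, snd e) \<in> c" by blast
        thus ?thesis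
        proof cases
          case (1 b)
          hence "b = snd e" using that(1) c(2) psubset.prems
            by (auto simp: partial_permutation_def intro: single_valuedD[of C "fst e"])
          thus ?thesis using 1 by simp
        next
          case (2 a)
          hence "a = fst e" using that(1) c(2) psubset.prems
            by (auto simp: partial_permutation_def intro: single_valuedD[of "C\<inverse>" "snd e"])
          thus ?thesis using 2 by simp
        qed
      qed
      have disj: "Field c \<inter> Field (C - c) = {}"
      proof (rule ccontr)
        assume "Field c \<inter> Field (C - c) \<noteq> {}"
        then obtain v where v: "v \<in> Field c" "v \<in> Field (C - c)" by blast
        then obtain e where "e \<in> C - c" "v = fst e \<or> v = snd e" by (force simp: Field_def)
        with v(1) have "e \<in> C - c" "fst e \<in> Field c \<or> snd e \<in> Field c" by auto
        thus False using ends by blast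
      qed
      have "Domain (C - c) = Domain C - Domain c" "Range (C - c) = Range C - Range c"
        using disj c(2) by (auto simp: Field_def)
      hence "partial_permutation (C - c)"
        using psubset.prems pc unfolding partial_permutation_def
        by (auto simp: single_valued_def)
      hence "multi_circuit A (C - c)"
        using psubset.prems c by (intro psubset.IH) auto
      then obtain F where F: "\<forall>d\<in>F. elementary_circuit A d"
        "pairwise (\<lambda>c d. Field c \<inter> Field d = {}) F" "C - c = \<Union>F"
        unfolding multi_circuit_def by (elim exE conjE) (rule that)
      have dF: "Field c \<inter> Field d = {}" if "d \<in> F" for d
      proof -
        have "d \<subseteq> C - c" using F(3) that by auto
        thus ?thesis using disj mono_Field by blast
      qed
      have "pairwise (\<lambda>c d. Field c \<inter> Field d = {}) (insert c F)"
        using F(2) dF by (auto simp: pairwise_insert)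
      moreover have "C = \<Union>(insert c F)" using F(3) c(2) by auto
      moreover have "\<forall>d\<in>insert c F. elementary_circuit A d" using F(1) c(1) by simp
      ultimately show ?thesis unfolding multi_circuit_def by (intro exI conjI)
    qed
  qed
qed

section \<open>Exchanging edges along an alternating cycle\<close>

text \<open>
  If every edge weight is a row potential plus a column potential, a matching weighs as much as
  any other matching of the same rows to the same columns.
\<close>

lemma sum_edges_potential:
  fixes u v :: "'a \<Rightarrow> real"
  assumes "single_valued P" "single_valued (P\<inverse>)" "\<forall>(i, j)\<in>P. f i j = ereal (u i + v j)"
  shows "(\<Sum>(i, j)\<in>P. f i j) = ereal (sum u (Domain P) + sum v (Range P))"
proof -
  have inj: "inj_on fst P" "inj_on snd P"
    using assms by (auto simp: inj_on_def dest: single_valuedD)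
  have "(\<Sum>(i, j)\<in>P. f i j) = (\<Sum>e\<in>P. ereal (u (fst e) + v (snd e)))"
    using assms(3) by (intro sum.cong) auto
  also have "\<dots> = ereal (sum u (fst ` P) + sum v (snd ` P))"
    by (simp add: sum.distrib sum.reindex[OF inj(1)] sum.reindex[OF inj(2)])
  finally show ?thesis by (simp add: Domain_fst Range_snd)
qed

lemma card_Domain_single_valued: "single_valued P \<Longrightarrow> card (Domain P) = card P"
  unfolding Domain_fst by (rule card_image) (auto simp: inj_on_def dest: single_valuedD)

lemma card_Range_single_valued: "single_valued (P\<inverse>) \<Longrightarrow> card (Range P) = card P"
  unfolding Range_snd by (rule card_image) (auto simp: inj_on_def dest: single_valuedD)

lemma partial_permutation_exchange:
  assumes C: "partial_permutation C" and "P \<subseteq> C"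
    and P': "single_valued P'" "single_valued (P'\<inverse>)" "Domain P' = Domain P" "Range P' = Range P"
  shows "partial_permutation ((C - P) \<union> P')"
proof -
  have sC: "single_valued C" "single_valued (C\<inverse>)" "Domain C = Range C"
    using C by (auto simp: partial_permutation_def)
  have 1: False if "(a, b) \<in> C - P" "a \<in> Domain P'" for a b
    using that single_valuedD[OF sC(1), of a b] P'(3) \<open>P \<subseteq> C\<close> by auto
  have 2: False if "(a, b) \<in> C - P" "b \<in> Range P'" for a b
    using that single_valuedD[OF sC(2), of b a] P'(4) \<open>P \<subseteq> C\<close> by auto
  have "single_valued ((C - P) \<union> P')"
    by (rule single_valuedI) (use 1 sC P'(1) in \<open>auto dest: single_valuedD\<close>)
  moreover have "single_valued (((C - P) \<union> P')\<inverse>)"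
    by (rule single_valuedI) (use 2 sC P'(2) in \<open>auto dest: single_valuedD\<close>)
  moreover have "Domain ((C - P) \<union> P') = Domain C"
    using \<open>P \<subseteq> C\<close> P'(3) by (auto simp: Domain_Un_eq)
  moreover have "Range ((C - P) \<union> P') = Range C"
    using \<open>P \<subseteq> C\<close> P'(4) by (auto simp: Range_Un_eq)
  ultimately show ?thesis using sC by (simp add: partial_permutation_def)
qed

text \<open>
  Leave a matched row by an edge of \<open>R\<close>, then take the matching edge back to a row: on
  the finite set of matched rows this gives a self-map \<open>g\<close>, and a nonempty set \<open>X\<close> of least size
  with \<open>g ` X \<subseteq> X\<close> is permuted by \<open>g\<close>.  The matching edges at \<open>X\<close> and the edges of \<open>R\<close> used
  by \<open>g\<close> at \<open>X\<close> then match the same rows with the same columns.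
\<close>

lemma exists_alternating_cycle:
  fixes M R :: "('a \<times> 'b) set"
  assumes "finite M" "M \<noteq> {}" and sv: "single_valued M" "single_valued (M\<inverse>)"
    and R: "\<forall>i\<in>Domain M. \<exists>j\<in>Range M. (i, j) \<in> R"
  obtains P P' where "P \<subseteq> M" "P' \<subseteq> R" "P' \<noteq> {}" "single_valued P'" "single_valued (P'\<inverse>)"
    "Domain P' = Domain P" "Range P' = Range P"
proof -
  obtain f where f: "\<And>i. i \<in> Domain M \<Longrightarrow> f i \<in> Range M \<and> (i, f i) \<in> R"
    using R by metis
  hence "\<forall>i\<in>Domain M. \<exists>k. (k, f i) \<in> M" by auto
  then obtain g where g: "\<And>i. i \<in> Domain M \<Longrightarrow> (g i, f i) \<in> M" by metis
  define Q where "Q X \<longleftrightarrow> X \<subseteq> Domain M \<and> X \<noteq> {} \<and> g ` X \<subseteq> X" for X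
  have "Q (Domain M)" using g \<open>M \<noteq> {}\<close> by (auto simp: Q_def)
  then obtain X where X: "Q X" and min: "\<And>Y. Q Y \<Longrightarrow> card X \<le> card Y"
    using ex_has_least_nat[of Q "Domain M" card] by blast
  have XD: "X \<subseteq> Domain M" "X \<noteq> {}" and gX: "g ` X \<subseteq> X" using X by (auto simp: Q_def)
  have fin: "finite X" using XD(1) \<open>finite M\<close> by (meson finite_Domain finite_subset)
  have "Q (g ` X)" using X unfolding Q_def by blast
  hence gXX: "g ` X = X" using min gX fin by (intro card_subset_eq) (auto intro: antisym card_image_le)
  hence inj: "inj_on g X" using fin by (intro eq_card_imp_inj_on) auto
  define P where "P = {(i, j) \<in> M. i \<in> X}"
  define P' where "P' = (\<lambda>i. (i, f i)) ` X"
  show ?thesis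
  proof (rule that)
    show "P \<subseteq> M" by (auto simp: P_def)
    show "P' \<subseteq> R" using f subsetD[OF XD(1)] by (auto simp: P'_def)
    show "P' \<noteq> {}" using XD by (simp add: P'_def)
    show "single_valued P'" by (auto simp: P'_def single_valued_def)
    have "i = i'" if "i \<in> X" "i' \<in> X" "f i = f i'" for i i'
    proof -
      have "(g i, f i) \<in> M" "(g i', f i) \<in> M" using g[of i] g[of i'] that XD by auto
      hence "g i = g i'" using single_valuedD[OF sv(2), of "f i" "g i" "g i'"] by simp
      thus ?thesis using inj that by (auto dest: inj_onD)
    qed
    thus "single_valued (P'\<inverse>)" by (auto simp: P'_def single_valued_def)
    show "Domain P' = Domain P" using XD by (force simp: P_def P'_def)
    show "Range P' = Range P"
    proof (intro equalityI subsetI)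
      fix j assume "j \<in> Range P'"
      then obtain i where "i \<in> X" "j = f i" by (auto simp: P'_def)
      hence "(g i, j) \<in> M" "g i \<in> X" using g[of i] XD gX by auto
      thus "j \<in> Range P" by (auto simp: P_def)
    next
      fix j assume "j \<in> Range P"
      then obtain i where i: "i \<in> X" "(i, j) \<in> M" by (auto simp: P_def)
      then obtain i' where i': "i' \<in> X" "i = g i'" using gXX by blast
      hence "(i, f i') \<in> M" using g[of i'] XD by auto
      hence "j = f i'" using i single_valuedD[OF sv(1)] by blast
      thus "j \<in> Range P'" using i' by (auto simp: P'_def)
    qed
  qed
qed

text \<open>
  An alternating cycle through edges whose weights come from potentials would turn \<open>C\<close> into a
  different multi-circuit of the same weight and length, hence another maximal one,
  which the star condition forbids.
\<close>

lemma star_condition_no_alternating_cycle: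
  fixes A :: "ereal ^ 'n ^ 'n::finite" and u v :: "'n \<Rightarrow> real"
  assumes star: "star_condition A" and "l \<in> rmax" and C: "maximal_multi_circuit A l C"
    and M: "M \<subseteq> C" and R: "R \<inter> C = {}" and pot: "\<forall>(i, j)\<in>M \<union> R. A $ i $ j = ereal (u i + v j)"
    and next_row: "\<forall>i\<in>Domain M. \<exists>j\<in>Range M. (i, j) \<in> R"
  shows "M = {}"
proof (rule ccontr)
  assume "M \<noteq> {}"
  have mc: "partial_permutation C" "\<forall>(i, j)\<in>C. A $ i $ j \<noteq> -\<infinity>"
    using C by (auto simp: maximal_multi_circuit_def multi_circuit_iff)
  have svC: "single_valued C" "single_valued (C\<inverse>)" using mc by (auto simp: partial_permutation_def)
  have sv: "single_valued M" "single_valued (M\<inverse>)"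
    using M svC single_valued_subset[of M C] single_valued_subset[of "M\<inverse>" "C\<inverse>"] by auto
  obtain P P' where P: "P \<subseteq> M" "P' \<subseteq> R" "P' \<noteq> {}" "single_valued P'" "single_valued (P'\<inverse>)"
    "Domain P' = Domain P" "Range P' = Range P"
    by (rule exists_alternating_cycle[OF finite \<open>M \<noteq> {}\<close> sv next_row])
  have svP: "single_valued P" "single_valued (P\<inverse>)"
    using P(1) sv single_valued_subset[of P M] single_valued_subset[of "P\<inverse>" "M\<inverse>"] by auto
  define C' where "C' = (C - P) \<union> P'"
  have PC: "P \<subseteq> C" using P(1) M by blast
  have disj: "(C - P) \<inter> P' = {}" using P(2) R by blast
  have "partial_permutation C'"
    unfolding C'_def by (rule partial_permutation_exchange[OF mc(1) PC P(4-7)])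
  moreover have "\<forall>(i, j)\<in>C'. A $ i $ j \<noteq> -\<infinity>"
  proof -
    have "\<forall>(i, j)\<in>R. A $ i $ j \<noteq> -\<infinity>" using pot by force
    thus ?thesis using mc(2) P(2) unfolding C'_def by blast
  qed
  ultimately have mc': "multi_circuit A C'" by (simp add: multi_circuit_iff)
  have "card P' = card P"
    using card_Domain_single_valued[OF P(4)] card_Domain_single_valued[OF svP(1)] P(6) by simp
  hence card: "card C' = card C"
    using disj PC by (simp add: C'_def card_Un_disjoint card_Diff_subset card_mono)
  have "mc_weight A P' = mc_weight A P"
  proof -
    have "\<forall>(i, j)\<in>P'. A $ i $ j = ereal (u i + v j)" "\<forall>(i, j)\<in>P. A $ i $ j = ereal (u i + v j)"
      using pot P(1,2) by blast+
    thus ?thesis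
      unfolding mc_weight_def
      by (simp add: sum_edges_potential[OF P(4,5)] sum_edges_potential[OF svP] P(6,7))
  qed
  moreover have "mc_weight A C' = mc_weight A (C - P) + mc_weight A P'"
    unfolding mc_weight_def C'_def using disj by (intro sum.union_disjoint) auto
  moreover have "mc_weight A C = mc_weight A (C - P) + mc_weight A P"
    unfolding mc_weight_def using PC by (intro sum.subset_diff) auto
  ultimately have "mc_weight A C' = mc_weight A C" by simp
  hence "mc_attains A t C' \<longleftrightarrow> mc_attains A t C" for t
    by (simp add: mc_attains_def card)
  hence "maximal_multi_circuit A l C'"
    using C mc' by (simp add: maximal_multi_circuit_def)
  moreover have "C' \<noteq> C" using P(2,3) R by (auto simp: C'_def)
  ultimately show False using star C card \<open>l \<in> rmax\<close> unfolding star_condition_def by metis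
qed

section \<open>Existence of maximal multi-circuits\<close>

definition mc_value :: "ereal ^ 'n ^ 'n \<Rightarrow> real \<Rightarrow> 'n::finite rel \<Rightarrow> real" where
  "mc_value A t C = real_of_ereal (mc_weight A C) + real (CARD('n) - card C) * t"

lemma mc_weight_real:
  fixes A :: "ereal ^ 'n ^ 'n::finite"
  assumes "A \<in> rmax_mat" "multi_circuit A C"
  shows "mc_weight A C = ereal (\<Sum>(i, j)\<in>C. real_of_ereal (A $ i $ j))"
proof -
  have "A $ i $ j = ereal (real_of_ereal (A $ i $ j))" if "(i, j) \<in> C" for i j
    using assms that by (cases "A $ i $ j") (auto simp: rmax_mat_def rmax_def multi_circuit_iff)
  hence "mc_weight A C = (\<Sum>e\<in>C. ereal (case e of (i, j) \<Rightarrow> real_of_ereal (A $ i $ j)))"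
    unfolding mc_weight_def by (intro sum.cong) auto
  thus ?thesis by simp
qed

lemma mc_value_eq:
  fixes A :: "ereal ^ 'n ^ 'n::finite"
  assumes "A \<in> rmax_mat" "multi_circuit A C"
  shows "mc_weight A C + mp_power (ereal t) (CARD('n) - card C) = ereal (mc_value A t C)"
  using mc_weight_real[OF assms] by (simp add: mc_value_def mp_power_def)

lemma mp_charpoly_eq:
  fixes A :: "ereal ^ 'n ^ 'n::finite"
  assumes "A \<in> rmax_mat"
  shows "mp_charpoly A (ereal t) = (MAX p\<in>{p. p permutes (UNIV :: 'n set)}.
     \<Sum>i\<in>UNIV. if p i = i then max (A $ i $ i) (ereal t) else A $ i $ p i)"
proof -
  have "mp_mat_add A (mp_mat_scale (ereal t) mp_unit_mat) $ i $ j =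
    (if j = i then max (A $ i $ i) (ereal t) else A $ i $ j)" for i j
    by (auto simp: mp_mat_add_def mp_mat_scale_def mp_unit_mat_def)
  thus ?thesis by (simp add: mp_charpoly_def mp_det_def)
qed

text \<open>
  Completing a multi-circuit by loops of weight \<open>t\<close> at the uncovered vertices gives a permutation,
  whose term in the determinant is at least the value of the multi-circuit.
\<close>

lemma mc_value_le_charpoly:
  fixes A :: "ereal ^ 'n ^ 'n::finite"
  assumes A: "A \<in> rmax_mat" and C: "multi_circuit A C"
  shows "ereal (mc_value A t C) \<le> mp_charpoly A (ereal t)"
proof -
  obtain s where s: "s permutes Domain C" "C = (\<lambda>i. (i, s i)) ` Domain C"
    using partial_permutation_extend C multi_circuit_iff by blast
  have w: "mc_weight A C = (\<Sum>i\<in>Domain C. A $ i $ s i)"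
    unfolding mc_weight_def by (subst s(2), subst sum.reindex) (auto simp: inj_on_def)
  have "card C = card (Domain C)"
    by (subst s(2), rule card_image) (auto simp: inj_on_def)
  hence pow: "mp_power (ereal t) (CARD('n) - card C) = (\<Sum>i\<in>- Domain C. ereal t)"
    by (simp add: mp_power_def Compl_eq_Diff_UNIV card_Diff_subset)
  have "ereal (mc_value A t C) = (\<Sum>i\<in>Domain C. A $ i $ s i) + (\<Sum>i\<in>- Domain C. ereal t)"
    using mc_value_eq[OF A C, of t] w pow by simp
  also have "\<dots> = (\<Sum>i\<in>UNIV. if i \<in> Domain C then A $ i $ s i else ereal t)"
    by (subst sum.If_cases) (auto simp: Compl_eq)
  also have "\<dots> \<le> (\<Sum>i\<in>UNIV. if s i = i then max (A $ i $ i) (ereal t) else A $ i $ s i)"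
    using s(1) by (intro sum_mono) (auto simp: permutes_def)
  also have "\<dots> \<le> mp_charpoly A (ereal t)"
    unfolding mp_charpoly_eq[OF A] using s(1)
    by (intro Max_ge) (auto intro!: imageI permutes_subset[of s "Domain C"] simp: finite_permutations)
  finally show ?thesis .
qed

text \<open>
  Conversely, take a permutation with the largest term and keep its edges, except the loops
  where \<open>t\<close> exceeds the diagonal entry of \<open>A\<close>.  No edge kept has weight \<open>-\<infinity>\<close>, because the identity
  permutation already gives a finite term.
\<close>

lemma exists_attaining_multi_circuit:
  fixes A :: "ereal ^ 'n ^ 'n::finite"
  assumes A: "A \<in> rmax_mat"
  obtains C where "multi_circuit A C" "mc_attains A t C"
proof -
  define E where "E p i = (if p i = i then max (A $ i $ i) (ereal t) else A $ i $ p i)" for p i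
  define PS where "PS = {p. p permutes (UNIV :: 'n set)}"
  have chi: "mp_charpoly A (ereal t) = (MAX p\<in>PS. \<Sum>i\<in>UNIV. E p i)"
    using mp_charpoly_eq[OF A] by (simp add: E_def PS_def)
  have PS: "finite PS" "id \<in> PS" by (auto simp: PS_def finite_permutations permutes_id)
  have "mp_charpoly A (ereal t) \<in> (\<lambda>p. \<Sum>i\<in>UNIV. E p i) ` PS"
    unfolding chi using PS by (intro Max_in) auto
  then obtain p where p: "p permutes UNIV" "mp_charpoly A (ereal t) = (\<Sum>i\<in>UNIV. E p i)"
    by (auto simp: PS_def)
  have "(\<Sum>i\<in>(UNIV::'n set). ereal t) \<le> (\<Sum>i\<in>UNIV. E id i)"
    by (intro sum_mono) (auto simp: E_def)
  also have "\<dots> \<le> mp_charpoly A (ereal t)" unfolding chi using PS by (intro Max_ge) auto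
  finally have fin: "(\<Sum>i\<in>UNIV. E p i) \<noteq> -\<infinity>" using p(2) by auto
  have Einf: "E p i \<noteq> \<infinity>" for i
    using A by (auto simp: E_def rmax_mat_def rmax_def max_def)
  have E: "E p i \<noteq> -\<infinity>" for i
  proof
    assume "E p i = -\<infinity>"
    moreover have "(\<Sum>j\<in>UNIV - {i}. E p j) \<noteq> \<infinity>" using Einf by (simp add: sum_Pinfty)
    ultimately have "(\<Sum>j\<in>UNIV. E p j) = -\<infinity>" by (simp add: sum.remove[of UNIV i])
    thus False using fin by simp
  qed
  define D where "D = {i. p i \<noteq> i \<or> ereal t \<le> A $ i $ i}"
  define C where "C = (\<lambda>i. (i, p i)) ` D"
  have injp: "inj p" using p(1) by (rule permutes_inj)
  have "p ` D \<subseteq> D" using injp by (auto simp: D_def inj_eq)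
  hence pD: "p ` D = D" using injp by (intro endo_inj_surj) (auto simp: inj_on_def)
  have "Domain C = D" by (force simp: C_def)
  moreover have "Range C = D" using pD by (force simp: C_def)
  moreover have "single_valued C" by (auto simp: C_def single_valued_def)
  moreover have "single_valued (C\<inverse>)" using injp by (auto simp: C_def single_valued_def inj_eq)
  ultimately have "partial_permutation C" by (simp add: partial_permutation_def)
  moreover have ED: "E p i = A $ i $ p i" if "i \<in> D" for i
    using that by (auto simp: E_def D_def)
  hence "\<forall>(i, j)\<in>C. A $ i $ j \<noteq> -\<infinity>" using E by (force simp: C_def)
  ultimately have mc: "multi_circuit A C" by (simp add: multi_circuit_iff)
  have w: "mc_weight A C = (\<Sum>i\<in>D. A $ i $ p i)"
    unfolding mc_weight_def C_def by (subst sum.reindex) (auto simp: inj_on_def)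
  have "card C = card D" unfolding C_def by (rule card_image) (auto simp: inj_on_def)
  hence pow: "mp_power (ereal t) (CARD('n) - card C) = (\<Sum>i\<in>- D. ereal t)"
    by (simp add: mp_power_def Compl_eq_Diff_UNIV card_Diff_subset)
  have "(\<Sum>i\<in>UNIV. E p i) = (\<Sum>i\<in>UNIV. if i \<in> D then A $ i $ p i else ereal t)"
    using ED by (intro sum.cong) (auto simp: E_def D_def)
  also have "\<dots> = (\<Sum>i\<in>D. A $ i $ p i) + (\<Sum>i\<in>- D. ereal t)"
    by (subst sum.If_cases) (auto simp: Compl_eq)
  finally have "mc_attains A t C" using w pow p(2) by (simp add: mc_attains_def)
  thus ?thesis using mc that by blast
qed

lemma affine_frequently_imp_eventually_at_bot:
  fixes a b :: real
  assumes "\<exists>\<^sub>F t in at_bot. a + b * t \<ge> 0"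
  shows "\<forall>\<^sub>F t in at_bot. a + b * t \<ge> 0"
proof (cases "b \<le> 0")
  case True
  obtain t0 where t0: "a + b * t0 \<ge> 0" using assms frequently_ex by blast
  have "a + b * t \<ge> 0" if "t \<le> t0" for t
    using mult_left_mono_neg[OF that True] t0 by simp
  thus ?thesis unfolding eventually_at_bot_linorder by blast
next
  case False
  have "a + b * t < 0" if "t \<le> - a / b - 1" for t
  proof -
    have "b * t \<le> b * (- a / b - 1)" using that False by (intro mult_left_mono) auto
    thus ?thesis using False by (simp add: algebra_simps)
  qed
  hence "\<forall>\<^sub>F t in at_bot. \<not> a + b * t \<ge> 0"
    unfolding eventually_at_bot_linorder not_le by blast
  thus ?thesis using assms by (simp add: frequently_def)
qed

text \<open>
  For \<open>l = -\<infinity>\<close> one multi-circuit has to attain the characteristic polynomial at all sufficiently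
  negative \<open>t\<close>.  Since there are finitely many, one of them does so at arbitrarily negative \<open>t\<close>; the
  values are affine in \<open>t\<close>, so this one is eventually at least as large as each of the others.
\<close>

lemma exists_maximal_multi_circuit:
  fixes A :: "ereal ^ 'n ^ 'n::finite"
  assumes A: "A \<in> rmax_mat"
  shows "\<exists>C. maximal_multi_circuit A l C"
proof (cases "l = -\<infinity>")
  case False
  then show ?thesis
    using exists_attaining_multi_circuit[OF A, of "real_of_ereal l"]
    by (metis maximal_multi_circuit_def)
next
  case True
  have att: "mc_attains A t C \<longleftrightarrow> mp_charpoly A (ereal t) = ereal (mc_value A t C)"
    if "multi_circuit A C" for t C
    using mc_value_eq[OF A that, of t] by (simp add: mc_attains_def)
  have "\<exists>C. multi_circuit A C \<and> (\<exists>\<^sub>F t in at_bot. mc_attains A t C)"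
  proof (rule ccontr)
    assume "\<not> ?thesis"
    hence "\<forall>C\<in>{C. multi_circuit A C}. \<forall>\<^sub>F t in at_bot. \<not> mc_attains A t C"
      by (auto simp: frequently_def)
    hence "\<forall>\<^sub>F t in at_bot. \<forall>C\<in>{C. multi_circuit A C}. \<not> mc_attains A t C"
      by (rule eventually_ball_finite[rotated]) simp
    hence "\<forall>\<^sub>F t::real in at_bot. False"
      by (rule eventually_mono) (use exists_attaining_multi_circuit[OF A] in blast)
    thus False by simp
  qed
  then obtain C where C: "multi_circuit A C" and freq: "\<exists>\<^sub>F t in at_bot. mc_attains A t C" by blast
  have "\<forall>\<^sub>F t in at_bot. mc_value A t D \<le> mc_value A t C" if D: "multi_circuit A D" for D
  proof -
    define a where "a = real_of_ereal (mc_weight A C) - real_of_ereal (mc_weight A D)"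
    define b where "b = real (CARD('n) - card C) - real (CARD('n) - card D)"
    have ab: "mc_value A t D \<le> mc_value A t C \<longleftrightarrow> a + b * t \<ge> 0" for t
      by (simp add: a_def b_def mc_value_def algebra_simps)
    have "\<exists>\<^sub>F t in at_bot. a + b * t \<ge> 0"
    proof (rule frequently_elim1[OF freq])
      fix t assume "mc_attains A t C"
      hence "ereal (mc_value A t D) \<le> ereal (mc_value A t C)"
        using mc_value_le_charpoly[OF A D, of t] att[OF C] by simp
      thus "a + b * t \<ge> 0" using ab by simp
    qed
    thus ?thesis using affine_frequently_imp_eventually_at_bot ab by simp
  qed
  hence "\<forall>\<^sub>F t in at_bot. \<forall>D\<in>{D. multi_circuit A D}. mc_value A t D \<le> mc_value A t C"
    by (intro eventually_ball_finite) auto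
  hence "\<forall>\<^sub>F t in at_bot. mc_attains A t C"
  proof (rule eventually_mono)
    fix t assume *: "\<forall>D\<in>{D. multi_circuit A D}. mc_value A t D \<le> mc_value A t C"
    obtain D where D: "multi_circuit A D" "mc_attains A t D"
      using exists_attaining_multi_circuit[OF A] .
    hence "mp_charpoly A (ereal t) \<le> ereal (mc_value A t C)" using * att by simp
    thus "mc_attains A t C"
      using mc_value_le_charpoly[OF A C, of t] att[OF C] by simp
  qed
  thus ?thesis using True C by (auto simp: maximal_multi_circuit_def)
qed

section \<open>Orthogonality as a closed, max-convex condition\<close>

text \<open>
  This is orthogonality, stated without reference to the value of the
  maximum; in this form it passes easily to suprema and limits.
\<close>

definition no_strict_maximum :: "ereal ^ 'n \<Rightarrow> ereal ^ 'n::finite \<Rightarrow> bool" where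
  "no_strict_maximum x y \<longleftrightarrow> (\<forall>i. \<exists>j. j \<noteq> i \<and> x $ i + y $ i \<le> x $ j + y $ j)"

lemma no_strict_maximum_imp_orthogonal:
  assumes "no_strict_maximum x y"
  shows "mp_orthogonal x y"
proof -
  have "mp_inner x y \<in> range (\<lambda>i. x $ i + y $ i)" unfolding mp_inner_def by (intro Max_in) auto
  then obtain i where i: "x $ i + y $ i = mp_inner x y" by auto
  obtain j where j: "j \<noteq> i" "x $ i + y $ i \<le> x $ j + y $ j"
    using assms unfolding no_strict_maximum_def by blast
  have "x $ j + y $ j \<le> mp_inner x y" unfolding mp_inner_def by (intro Max_ge) auto
  hence "x $ j + y $ j = mp_inner x y" using i j by simp
  thus ?thesis using i j(1) unfolding mp_orthogonal_def by blast
qed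

lemma no_strict_maximum_commute: "no_strict_maximum x y \<longleftrightarrow> no_strict_maximum y x"
  by (simp add: no_strict_maximum_def add.commute)

text \<open>
  At a given index the supremum is the entry of a single member of the family, because all but
  finitely many members are trivial; the index that this member provides also serves the supremum.
\<close>

lemma no_strict_maximum_SUP:
  fixes f :: "'k \<Rightarrow> ereal ^ 'n::finite"
  assumes "K \<noteq> {}" and fin: "finite {k \<in> K. f k \<noteq> mp_zero_vec}"
    and nsm: "\<And>k. k \<in> K \<Longrightarrow> no_strict_maximum (f k) y"
  shows "no_strict_maximum (\<chi> i. SUP k\<in>K. f k $ i) y"
  unfolding no_strict_maximum_def
proof
  fix i
  have "(\<lambda>k. f k $ i) ` K \<subseteq> insert (-\<infinity>) ((\<lambda>k. f k $ i) ` {k \<in> K. f k \<noteq> mp_zero_vec})"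
    by (auto simp: mp_zero_vec_def)
  hence finV: "finite ((\<lambda>k. f k $ i) ` K)" using fin by (meson finite_imageI finite_insert finite_subset)
  hence "(SUP k\<in>K. f k $ i) \<in> (\<lambda>k. f k $ i) ` K"
    using \<open>K \<noteq> {}\<close> by (simp add: cSup_eq_Max Max_in)
  then obtain k where k: "k \<in> K" "(SUP k\<in>K. f k $ i) = f k $ i" by blast
  obtain j where j: "j \<noteq> i" "f k $ i + y $ i \<le> f k $ j + y $ j"
    using nsm[OF k(1)] unfolding no_strict_maximum_def by blast
  have "f k $ j \<le> (SUP k\<in>K. f k $ j)" using k(1) by (rule SUP_upper)
  hence "f k $ i + y $ i \<le> (SUP k\<in>K. f k $ j) + y $ j"
    using j(2) add_right_mono order_trans by blast
  thus "\<exists>j. j \<noteq> i \<and> (\<chi> i. SUP k\<in>K. f k $ i) $ i + y $ i \<le> (\<chi> i. SUP k\<in>K. f k $ i) $ j + y $ j"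
    using j(1) k(2) by auto
qed

lemma no_strict_maximum_limit:
  fixes f g :: "'k \<Rightarrow> ereal ^ 'n::finite"
  assumes F: "F \<noteq> bot" and f: "(f \<longlongrightarrow> x) F" and g: "(g \<longlongrightarrow> y) F"
    and ev: "\<forall>\<^sub>F d in F. no_strict_maximum (f d) (g d)"
    and "x \<in> rmax_vec" "y \<in> rmax_vec"
  shows "no_strict_maximum x y"
proof (rule ccontr)
  assume "\<not> no_strict_maximum x y"
  then obtain i where i: "\<And>j. j \<noteq> i \<Longrightarrow> x $ j + y $ j < x $ i + y $ i"
    unfolding no_strict_maximum_def not_all not_ex by (auto simp: not_le)
  have lim: "((\<lambda>d. f d $ j + g d $ j) \<longlongrightarrow> x $ j + y $ j) F" for j
    using assms(5,6) by (intro tendsto_add_ereal_general tendsto_vec_nth f g)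
      (auto simp: rmax_vec_def rmax_def)
  have "\<forall>\<^sub>F d in F. f d $ j + g d $ j < f d $ i + g d $ i" if "j \<noteq> i" for j
  proof -
    obtain c where "x $ j + y $ j < c" "c < x $ i + y $ i" using i \<open>j \<noteq> i\<close> dense by blast
    hence "\<forall>\<^sub>F d in F. f d $ j + g d $ j < c" "\<forall>\<^sub>F d in F. c < f d $ i + g d $ i"
      using order_tendstoD lim by blast+
    thus ?thesis by eventually_elim simp
  qed
  hence "\<forall>\<^sub>F d in F. \<forall>j\<in>- {i}. f d $ j + g d $ j < f d $ i + g d $ i"
    by (intro eventually_ball_finite) auto
  with ev have "\<forall>\<^sub>F d in F. False"
  proof eventually_elim
    case (elim d)
    then obtain j where "j \<noteq> i" "f d $ i + g d $ i \<le> f d $ j + g d $ j"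
      unfolding no_strict_maximum_def by blast
    thus False using elim(2) by (auto simp: not_less[symmetric])
  qed
  thus False using F by simp
qed

section \<open>Orthogonality of right and left vectors of a generic matrix\<close>

text \<open>
  Row \<open>i\<close> of the defining equation compares the products \<open>A $ i $ j + x $ j\<close> and \<open>l + x $ i\<close>.
  One side consists of the single product selected by \<open>C\<close>: the one of the edge leaving
  \<open>i\<close>, or \<open>l + x $ i\<close> if there is none.  So the largest product \<open>m\<close> is attained by the selected
  product and by another one.
\<close>

lemma circuit_space_row:
  fixes A :: "ereal ^ 'n ^ 'n::finite"
  assumes "l \<in> rmax" and C: "multi_circuit A C" and x: "x \<in> circuit_space A l C"
    and m: "m \<noteq> -\<infinity>" "\<And>j. A $ i $ j + x $ j \<le> m" "l + x $ i \<le> m"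
      "(\<exists>j. A $ i $ j + x $ j = m) \<or> l + x $ i = m"
  shows "(\<exists>s. (i, s) \<in> C \<and> A $ i $ s + x $ s = m \<and>
            (l + x $ i = m \<or> (\<exists>j. (i, j) \<notin> C \<and> A $ i $ j + x $ j = m)))
       \<or> (i \<notin> Domain C \<and> l + x $ i = m \<and> (\<exists>j. A $ i $ j + x $ j = m))"
proof -
  have lfin: "l + -\<infinity> = -\<infinity>" using \<open>l \<in> rmax\<close> by (auto simp: rmax_def)
  have xfin: "-\<infinity> + x $ j = -\<infinity>" for j
    using x by (auto simp: circuit_space_def rmax_vec_def rmax_def)
  have pc: "partial_permutation C" using C by (simp add: multi_circuit_iff)
  have F: "Field C = Domain C" using pc by (rule partial_permutation_Field)
  define L where "L j = max (if (i, j) \<in> C then -\<infinity> else A $ i $ j)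
    (if i = j \<and> i \<in> Domain C then l else -\<infinity>) + x $ j" for j
  define R where "R j = max (if (i, j) \<in> C then A $ i $ j else -\<infinity>)
    (if i = j \<and> i \<notin> Domain C then l else -\<infinity>) + x $ j" for j
  have L: "mp_mat_vec (mp_mat_add (mat_off A C) (mp_mat_scale l (unit_on C))) x $ i = (MAX j. L j)"
    by (simp add: mp_mat_vec_def mp_mat_add_def mat_off_def mp_mat_scale_def unit_on_def L_def F
        if_distrib[of "\<lambda>z. l + z"] lfin cong: if_cong)
  have R: "mp_mat_vec (mp_mat_add (mat_on A C) (mp_mat_scale l (unit_off C))) x $ i = (MAX j. R j)"
    by (simp add: mp_mat_vec_def mp_mat_add_def mat_on_def mp_mat_scale_def unit_off_def R_def F
        if_distrib[of "\<lambda>z. l + z"] lfin cong: if_cong)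
  have LR: "(MAX j. L j) = (MAX j. R j)"
    using x unfolding L[symmetric] R[symmetric] circuit_space_def by simp
  have L_le: "L j \<le> m" and R_le: "R j \<le> m" for j
    using m(2)[of j] m(3) by (auto simp: L_def R_def max_def xfin)
  have "\<exists>j. L j = m \<or> R j = m"
  proof (cases "l + x $ i = m")
    case True
    have "m \<le> L i \<or> m \<le> R i"
      using True add_right_mono[OF max.cobounded2, of l "x $ i"] by (auto simp: L_def R_def)
    thus ?thesis using L_le[of i] R_le[of i] by (metis antisym)
  next
    case False
    then obtain j where "A $ i $ j + x $ j = m" using m(4) by blast
    hence "m \<le> L j \<or> m \<le> R j"
      using add_right_mono[OF max.cobounded1, of "A $ i $ j" "x $ j"] by (auto simp: L_def R_def)
    thus ?thesis using L_le[of j] R_le[of j] by (metis antisym)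
  qed
  hence "(MAX j. L j) = m \<or> (MAX j. R j) = m"
  proof (elim exE disjE)
    fix j assume "L j = m"
    hence "(MAX j. L j) = m" using L_le by (intro Max_eqI) auto
    thus ?thesis ..
  next
    fix j assume "R j = m"
    hence "(MAX j. R j) = m" using R_le by (intro Max_eqI) auto
    thus ?thesis ..
  qed
  hence LRm: "(MAX j. L j) = m" "(MAX j. R j) = m" using LR by auto
  have "(MAX j. L j) \<in> range L" "(MAX j. R j) \<in> range R" by (auto intro!: Max_in)
  then obtain jl jr where jl: "L jl = m" and jr: "R jr = m" using LRm by auto
  have jl': "((i, jl) \<notin> C \<and> A $ i $ jl + x $ jl = m) \<or> (i = jl \<and> i \<in> Domain C \<and> l + x $ i = m)"
    using jl m(1) by (auto simp: L_def max_def xfin split: if_splits)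
  have jr': "((i, jr) \<in> C \<and> A $ i $ jr + x $ jr = m) \<or> (i = jr \<and> i \<notin> Domain C \<and> l + x $ i = m)"
    using jr m(1) by (auto simp: R_def max_def xfin split: if_splits)
  show ?thesis using jl' jr' by blast
qed

text \<open>
  Suppose that \<open>x $ i + y $ i\<close> has a strict maximum \<open>K\<close>, at \<open>i0\<close>.  Let \<open>S\<close> be the set of positions where
  \<open>y $ i + A $ i $ j + x $ j\<close> takes its maximum \<open>T\<close>, seen as a bipartite graph between rows and columns;
  on \<open>S\<close> the entries of \<open>A\<close> are sums of potentials.  The row of \<open>i0\<close> shows \<open>l + K \<le> T\<close>, and so
  \<open>m + K < T\<close>.  Therefore the eigenvalue terms never take part in a column of \<open>S\<close>, and
  can take part in a row only at \<open>i0\<close>.  This leaves: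
  \<^item> each column of \<open>S\<close> has an edge of \<open>D\<close> (reversed) in \<open>S\<close> and another edge in \<open>S\<close>;
  \<^item> each row of \<open>S\<close> other than \<open>i0\<close> has an edge of \<open>C\<close> in \<open>S\<close> and another edge in \<open>S\<close>.
  
  So \<open>D\<close> matches the columns of \<open>S\<close> into its rows.  If this uses up all rows, the other edge at each
  column yields an alternating cycle for \<open>D\<close>.  Otherwise there are fewer columns than rows, so the edges
  of \<open>C\<close> can only match the rows other than \<open>i0\<close>, and they use up all columns; now the other
  edge at each of these rows yields an alternating cycle for \<open>C\<close>.  Both contradict the star condition.
\<close>

lemma no_strict_maximum_circuit_spaces_less:
  fixes A :: "ereal ^ 'n ^ 'n::finite" and x y :: "ereal ^ 'n"
  assumes A: "A \<in> rmax_mat" and star: "star_condition A" "star_condition (transpose A)"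
    and l: "l \<in> rmax" and m: "m \<in> rmax" and "m < l"
    and C: "maximal_multi_circuit A l C" and D: "maximal_multi_circuit (transpose A) m D"
    and x: "x \<in> circuit_space A l C" and y: "y \<in> circuit_space (transpose A) m D"
    and card: "CARD('n) \<ge> 2"
  shows "no_strict_maximum x y"
proof (rule ccontr)
  assume "\<not> no_strict_maximum x y"
  then obtain i0 where i0: "\<And>j. j \<noteq> i0 \<Longrightarrow> x $ j + y $ j < x $ i0 + y $ i0"
    unfolding no_strict_maximum_def not_all not_ex by (auto simp: not_le)
  have mcC: "multi_circuit A C" and mcD: "multi_circuit (transpose A) D"
    using C D by (auto simp: maximal_multi_circuit_def)
  have svC: "single_valued C" "single_valued (C\<inverse>)" and svD: "single_valued D" "single_valued (D\<inverse>)"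
    using mcC mcD by (auto simp: multi_circuit_iff partial_permutation_def)
  have fin: "x $ i \<noteq> \<infinity>" "y $ i \<noteq> \<infinity>" "A $ i $ j \<noteq> \<infinity>" for i j
    using x y A by (auto simp: circuit_space_def rmax_vec_def rmax_mat_def rmax_def)
  have lm: "l \<noteq> \<infinity>" "m \<noteq> \<infinity>" "l \<noteq> -\<infinity>" using l m \<open>m < l\<close> by (auto simp: rmax_def)
  define K where "K = x $ i0 + y $ i0"
  obtain j1 where "j1 \<noteq> i0" using card by (metis (full_types) UNIV_I card_1_singleton_iff
        card_le_Suc0_iff_eq finite not_less_eq_eq numeral_2_eq_2)
  hence "x $ j1 + y $ j1 < K" using i0[of j1] by (simp add: K_def)
  hence K: "K \<noteq> -\<infinity>" by auto
  obtain x0 y0 l0 where real: "x $ i0 = ereal x0" "y $ i0 = ereal y0" "l = ereal l0"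
    using K fin(1,2)[of i0] lm by (cases "x $ i0"; cases "y $ i0"; cases l) (auto simp: K_def)
  define t where "t i j = y $ i + A $ i $ j + x $ j" for i j
  define T where "T = (MAX e. t (fst e) (snd e))"
  have tT: "t i j \<le> T" for i j
  proof -
    have "t (fst (i, j)) (snd (i, j)) \<le> T" unfolding T_def by (intro Max_ge rangeI) simp
    thus ?thesis by simp
  qed
  \<comment> \<open>In the row of \<open>i0\<close> the largest product is attained twice, hence by some \<open>A $ i0 $ j + x $ j\<close>.\<close>
  have lK: "l + K \<le> T"
  proof -
    define r where "r = max (MAX j. A $ i0 $ j + x $ j) (l + x $ i0)"
    have r1: "A $ i0 $ j + x $ j \<le> r" for j
      unfolding r_def by (intro max.coboundedI1 Max_ge) auto
    have r2: "l + x $ i0 \<le> r" by (simp add: r_def)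
    have r3: "r \<noteq> -\<infinity>" using r2 real by auto
    have "(MAX j. A $ i0 $ j + x $ j) \<in> range (\<lambda>j. A $ i0 $ j + x $ j)" by (intro Max_in) auto
    then obtain k where "(MAX j. A $ i0 $ j + x $ j) = A $ i0 $ k + x $ k" by blast
    hence "A $ i0 $ k + x $ k = r \<or> l + x $ i0 = r" by (simp add: r_def max_def)
    hence "(\<exists>j. A $ i0 $ j + x $ j = r) \<or> l + x $ i0 = r" by blast
    hence "\<exists>j. A $ i0 $ j + x $ j = r"
      using circuit_space_row[OF l mcC x r3 r1 r2] by blast
    then obtain j where "A $ i0 $ j + x $ j = r" by blast
    hence "t i0 j = y $ i0 + r" by (simp add: t_def add.assoc)
    moreover have "l + K \<le> y $ i0 + r" using add_left_mono[OF r2, of "y $ i0"]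
      by (simp add: K_def ac_simps)
    ultimately show ?thesis using tT[of i0 j] by simp
  qed
  hence T: "T \<noteq> -\<infinity>" "T \<noteq> \<infinity>"
  proof -
    show "T \<noteq> -\<infinity>" using lK real by (auto simp: K_def)
    have "T \<in> range (\<lambda>e. t (fst e) (snd e))" unfolding T_def by (intro Max_in) auto
    thus "T \<noteq> \<infinity>" using fin by (auto simp: t_def)
  qed
  have mK: "m + K < T"
  proof -
    have "m + K < l + K" using \<open>m < l\<close> real lm by (cases m) (auto simp: K_def)
    thus ?thesis using lK by simp
  qed
  have le_K: "x $ i + y $ i \<le> K" for i using i0[of i] by (cases "i = i0") (auto simp: K_def)
  define S where "S = {(i, j). t i j = T}"
  obtain T0 where T0: "T = ereal T0" using T by (cases T) auto
  define u where "u i = T0 - real_of_ereal (y $ i)" for i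
  define v where "v j = - real_of_ereal (x $ j)" for j
  have Sreal: "y $ i = ereal (real_of_ereal (y $ i)) \<and> x $ j = ereal (real_of_ereal (x $ j)) \<and>
      A $ i $ j = ereal (u i + v j)" if "(i, j) \<in> S" for i j
  proof -
    have "t i j = ereal T0" using that T0 by (simp add: S_def)
    thus ?thesis using fin(1)[of j] fin(2)[of i] fin(3)[of i j]
      by (cases "y $ i"; cases "x $ j"; cases "A $ i $ j") (auto simp: t_def u_def v_def)
  qed
  \<comment> \<open>Where row \<open>i\<close> meets \<open>S\<close>, its largest product is \<open>T - y $ i\<close>, and the products attaining it are the
      positions in \<open>S\<close>, together with \<open>l + x $ i\<close> possibly if \<open>i = i0\<close>.\<close>
  have row: "(\<exists>s. (i, s) \<in> C \<and> (i, s) \<in> S \<and> (i = i0 \<or> (\<exists>j. (i, j) \<in> S - C))) \<or>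
      (i = i0 \<and> i \<notin> Domain C)" if iS: "i \<in> Domain S" for i
  proof -
    obtain j where j: "(i, j) \<in> S" using iS by blast
    obtain y1 where y1: "y $ i = ereal y1" using Sreal[OF j] by blast
    define r where "r = A $ i $ j + x $ j"
    have tr: "t i k = ereal y1 + (A $ i $ k + x $ k)" for k by (simp add: t_def y1 add.assoc)
    have rT: "ereal y1 + r = T" using j tr by (simp add: S_def r_def)
    have canc: "a \<le> r" if "ereal y1 + a \<le> T" for a
      using that unfolding rT[symmetric] by (cases a; cases r) auto
    have canc': "a = r \<longleftrightarrow> ereal y1 + a = T" for a
      unfolding rT[symmetric] by (cases a; cases r) auto
    have r3: "r \<noteq> -\<infinity>" using rT T by auto
    have r1: "A $ i $ k + x $ k \<le> r" for k using canc tr[of k] tT[of i k] by simp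
    have eq: "ereal y1 + (l + x $ i) = l + (x $ i + y $ i)" by (simp add: y1 ac_simps)
    have r2: "l + x $ i \<le> r"
      using canc[of "l + x $ i"] add_left_mono[OF le_K[of i], of l] lK unfolding eq
      by (meson order_trans)
    have i: "i = i0" if "l + x $ i = r"
    proof (rule ccontr)
      assume "i \<noteq> i0"
      hence "l + (x $ i + y $ i) < l + K" using i0[of i] real fin(1,2)[of i]
        by (cases "x $ i"; cases "y $ i") (auto simp: K_def)
      thus False using that canc' lK eq by simp
    qed
    have inS: "(i, k) \<in> S \<longleftrightarrow> A $ i $ k + x $ k = r" for k using canc' tr by (simp add: S_def)
    from circuit_space_row[OF l mcC x r3 r1 r2] show ?thesis using i inS r_def by auto
  qed
  \<comment> \<open>The same for columns, with \<open>m + y $ j\<close> always too small to attain.\<close>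
  have col: "\<exists>s. (j, s) \<in> D \<and> (s, j) \<in> S \<and> (\<exists>i. (i, j) \<in> S \<and> (j, i) \<notin> D)" if jS: "j \<in> Range S" for j
  proof -
    obtain i where i: "(i, j) \<in> S" using jS by blast
    obtain x1 where x1: "x $ j = ereal x1" using Sreal[OF i] by blast
    define r where "r = A $ i $ j + y $ i"
    have tr: "t k j = ereal x1 + (transpose A $ j $ k + y $ k)" for k
      by (simp add: t_def x1 transpose_def ac_simps)
    have rT: "ereal x1 + r = T" using i tr by (simp add: S_def r_def transpose_def)
    have canc: "a \<le> r" if "ereal x1 + a \<le> T" for a
      using that unfolding rT[symmetric] by (cases a; cases r) auto
    have canc': "a = r \<longleftrightarrow> ereal x1 + a = T" for a
      unfolding rT[symmetric] by (cases a; cases r) auto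
    have r3: "r \<noteq> -\<infinity>" using rT T by auto
    have r1: "transpose A $ j $ k + y $ k \<le> r" for k using canc tr[of k] tT[of k j] by simp
    have eq: "ereal x1 + (m + y $ j) = m + (x $ j + y $ j)" by (simp add: x1 ac_simps)
    have lt: "ereal x1 + (m + y $ j) < T"
      using add_left_mono[OF le_K[of j], of m] mK unfolding eq by (rule order_le_less_trans)
    have r2: "m + y $ j \<le> r" and ne: "m + y $ j \<noteq> r" using canc lt canc' by auto
    have inS: "(k, j) \<in> S \<longleftrightarrow> transpose A $ j $ k + y $ k = r" for k
      using canc' tr by (simp add: S_def)
    have "transpose A $ j $ i + y $ i = r" by (simp add: r_def transpose_def)
    from circuit_space_row[OF m mcD y r3 r1 r2] this show ?thesis using ne inS by blast
  qed
  have Sne: "S \<noteq> {}"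
  proof -
    have "T \<in> range (\<lambda>e. t (fst e) (snd e))" unfolding T_def by (intro Max_in) auto
    thus ?thesis by (auto simp: S_def)
  qed
  define N where "N = D \<inter> S\<inverse>"
  have svN: "single_valued N" "single_valued (N\<inverse>)"
    using svD single_valued_subset[of N D] single_valued_subset[of "N\<inverse>" "D\<inverse>"] by (auto simp: N_def)
  have DomN: "Domain N = Range S" using col by (auto simp: N_def)
  have RanN: "Range N \<subseteq> Domain S" by (auto simp: N_def)
  have cN: "card (Range N) = card (Range S)"
    using card_Domain_single_valued[OF svN(1)] card_Range_single_valued[OF svN(2)] DomN by simp
  have "Range N \<noteq> Domain S"
  proof
    assume RN: "Range N = Domain S"
    have "N = {}"
    proof (rule star_condition_no_alternating_cycle[OF star(2) m D])
      show "N \<subseteq> D" by (auto simp: N_def)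
      show "(S\<inverse> - D) \<inter> D = {}" by auto
      show "\<forall>(j, i)\<in>N \<union> (S\<inverse> - D). transpose A $ j $ i = ereal (v j + u i)"
        using Sreal by (auto simp: N_def transpose_def add.commute)
      show "\<forall>j\<in>Domain N. \<exists>i\<in>Range N. (j, i) \<in> S\<inverse> - D"
        unfolding DomN RN using col by blast
    qed
    thus False using DomN Sne by auto
  qed
  \<comment> \<open>\<open>N\<close> leaves a row uncovered, so there are more rows than columns, and \<open>M\<close> misses \<open>i0\<close>.\<close>
  hence less: "card (Range S) < card (Domain S)"
    using RanN psubset_card_mono[of "Domain S" "Range N"] cN by auto
  define M where "M = C \<inter> S"
  have svM: "single_valued M" "single_valued (M\<inverse>)"
    using svC single_valued_subset[of M C] single_valued_subset[of "M\<inverse>" "C\<inverse>"] by (auto simp: M_def)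
  have cM: "card (Range M) = card (Domain M)"
    using card_Domain_single_valued[OF svM(1)] card_Range_single_valued[OF svM(2)] by simp
  have RanM: "Range M \<subseteq> Range S" by (auto simp: M_def)
  have DomM1: "Domain S - {i0} \<subseteq> Domain M" using row by (auto simp: M_def)
  have DomM2: "Domain M \<subseteq> Domain S" by (auto simp: M_def)
  have i0M: "i0 \<notin> Domain M"
  proof
    assume "i0 \<in> Domain M"
    hence "Domain M = Domain S" using DomM1 DomM2 by auto
    thus False using cM less card_mono[OF finite RanM] by simp
  qed
  hence DomM: "Domain M = Domain S - {i0}" using DomM1 DomM2 by auto
  have "card (Domain S) \<le> Suc (card (Domain M))"
    unfolding DomM by (metis card_Diff1_le card_Suc_Diff1 diff_card_le_card_Diff Diff_empty Diff_insert0
        finite le_SucI order_refl)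
  hence RanM': "Range M = Range S" using less cM RanM by (intro card_seteq) auto
  have "M = {}"
  proof (rule star_condition_no_alternating_cycle[OF star(1) l C])
    show "M \<subseteq> C" by (auto simp: M_def)
    show "(S - C) \<inter> C = {}" by auto
    show "\<forall>(i, j)\<in>M \<union> (S - C). A $ i $ j = ereal (u i + v j)"
      using Sreal by (auto simp: M_def)
    show "\<forall>i\<in>Domain M. \<exists>j\<in>Range M. (i, j) \<in> S - C"
    proof
      fix i assume "i \<in> Domain M"
      hence "i \<in> Domain S" "i \<noteq> i0" using DomM by auto
      then obtain j where "(i, j) \<in> S - C" using row by blast
      thus "\<exists>j\<in>Range M. (i, j) \<in> S - C" unfolding RanM' by blast
    qed
  qed
  thus False using RanM' Sne by auto
qed

lemma no_strict_maximum_circuit_spaces: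
  fixes A :: "ereal ^ 'n ^ 'n::finite" and x y :: "ereal ^ 'n"
  assumes A: "A \<in> rmax_mat" and star: "star_condition A" "star_condition (transpose A)"
    and l: "l \<in> rmax" and m: "m \<in> rmax" and "l \<noteq> m"
    and C: "maximal_multi_circuit A l C" and D: "maximal_multi_circuit (transpose A) m D"
    and x: "x \<in> circuit_space A l C" and y: "y \<in> circuit_space (transpose A) m D"
    and card: "CARD('n) \<ge> 2"
  shows "no_strict_maximum x y"
proof (cases "m < l")
  case True
  thus ?thesis using no_strict_maximum_circuit_spaces_less[OF A star l m _ C D x y card] by blast
next
  case False
  hence "l < m" using \<open>l \<noteq> m\<close> by simp
  moreover have "transpose A \<in> rmax_mat" using A by (simp add: rmax_mat_def transpose_def)
  ultimately have "no_strict_maximum y x"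
    using no_strict_maximum_circuit_spaces_less[of "transpose A" m l D C y x] star l m C D x y card
    by (simp add: transpose_transpose)
  thus ?thesis by (simp add: no_strict_maximum_commute)
qed

section \<open>Generic perturbations\<close>

lemma perturb_rmax_mat: "A \<in> rmax_mat \<Longrightarrow> perturb A z d \<in> rmax_mat"
  by (auto simp: rmax_mat_def rmax_def perturb_def ereal_minus_eq_PInfty_iff)

lemma multi_circuit_perturb:
  fixes A :: "ereal ^ 'n ^ 'n::finite"
  shows "multi_circuit (perturb A z d) C \<longleftrightarrow> multi_circuit A C"
proof -
  have "a - ereal r = -\<infinity> \<longleftrightarrow> a = -\<infinity>" for a r by (cases a) auto
  thus ?thesis by (simp add: multi_circuit_iff perturb_def)
qed

lemma mc_weight_perturb:
  fixes A :: "ereal ^ 'n ^ 'n::finite"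
  assumes A: "A \<in> rmax_mat" and C: "multi_circuit A C"
  shows "mc_weight (perturb A z d) C =
    ereal ((\<Sum>(i, j)\<in>C. real_of_ereal (A $ i $ j)) - d * (\<Sum>(i, j)\<in>C. z $ i $ j))"
proof -
  have "real_of_ereal (perturb A z d $ i $ j) = real_of_ereal (A $ i $ j) - d * z $ i $ j"
    if "(i, j) \<in> C" for i j
    using A C that by (cases "A $ i $ j") (auto simp: rmax_mat_def rmax_def multi_circuit_iff perturb_def)
  hence "(\<Sum>(i, j)\<in>C. real_of_ereal (perturb A z d $ i $ j)) =
    (\<Sum>e\<in>C. (case e of (i, j) \<Rightarrow> real_of_ereal (A $ i $ j)) - d * (case e of (i, j) \<Rightarrow> z $ i $ j))"
    by (intro sum.cong) auto
  thus ?thesis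
    using mc_weight_real[OF perturb_rmax_mat[OF A], of z d C] C
    by (simp add: multi_circuit_perturb sum_subtractf sum_distrib_left)
qed

text \<open>
  Directions with this property separate any two multi-circuits of equal weight to first order
  in \<open>d\<close>, and the property is invariant under transposition.
\<close>

definition distinct_edge_sums :: "real ^ 'n ^ 'n \<Rightarrow> bool" where
  "distinct_edge_sums z \<longleftrightarrow> inj (\<lambda>C :: 'n rel. \<Sum>(i, j)\<in>C. z $ i $ j)"

text \<open>
  Two maximal multi-circuits of the same length have the same perturbed weight.  For different
  multi-circuits the perturbed weights are affine in \<open>d\<close> with different slopes, so they agree for at
  most one \<open>d\<close>, and finitely many such \<open>d\<close> are avoided near \<open>0\<close>.
\<close>

lemma distinct_edge_sums_good_direction:
  fixes A :: "ereal ^ 'n ^ 'n::finite"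
  assumes A: "A \<in> rmax_mat" and z: "\<forall>i j. z $ i $ j \<in> {0..1}" and dist: "distinct_edge_sums z"
  shows "z \<in> good_directions A"
proof -
  define w where "w C = (\<Sum>(i, j)\<in>C. real_of_ereal (A $ i $ j))" for C
  define s where "s C = (\<Sum>(i, j)\<in>C. z $ i $ j)" for C
  have "\<forall>\<^sub>F d in at_right 0. w C - d * s C \<noteq> w D - d * s D" if "C \<noteq> D" for C D
  proof -
    have ne: "s C \<noteq> s D" using dist that by (auto simp: distinct_edge_sums_def s_def dest: injD)
    have "\<forall>\<^sub>F d in at_right 0. d \<noteq> (w C - w D) / (s C - s D)" by (rule eventually_neq_at_within)
    thus ?thesis
      by eventually_elim (use ne in \<open>auto simp: field_simps\<close>)
  qed
  hence "\<forall>\<^sub>F d in at_right 0. \<forall>e\<in>{(C, D). C \<noteq> D}.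
      w (fst e) - d * s (fst e) \<noteq> w (snd e) - d * s (snd e)"
    by (intro eventually_ball_finite) auto
  then obtain b where b: "b > 0" "\<And>d C D. \<lbrakk>0 < d; d < b; C \<noteq> D\<rbrakk> \<Longrightarrow> w C - d * s C \<noteq> w D - d * s D"
    unfolding eventually_at_right_field by fastforce
  have "star_condition (perturb A z d)" if d: "0 < d" "d < b" for d
    unfolding star_condition_def
  proof (intro ballI allI impI notI)
    fix l C D
    let ?B = "perturb A z d"
    assume *: "maximal_multi_circuit ?B l C \<and> maximal_multi_circuit ?B l D \<and> C \<noteq> D"
      and card: "card C = card D"
    have C: "multi_circuit A C" and D: "multi_circuit A D"
      using * by (auto simp: maximal_multi_circuit_def multi_circuit_perturb)
    have "\<exists>t. mc_attains ?B t C \<and> mc_attains ?B t D"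
    proof (cases "l = -\<infinity>")
      case True
      hence "\<forall>\<^sub>F t in at_bot. mc_attains ?B t C \<and> mc_attains ?B t D"
        using * by (auto simp: maximal_multi_circuit_def eventually_conj_iff)
      thus ?thesis using eventually_happens by fastforce
    next
      case False
      thus ?thesis using * by (auto simp: maximal_multi_circuit_def)
    qed
    then obtain t where "mc_attains ?B t C" "mc_attains ?B t D" by blast
    hence "mc_weight ?B C + mp_power (ereal t) (CARD('n) - card D) =
        mc_weight ?B D + mp_power (ereal t) (CARD('n) - card D)"
      by (simp add: mc_attains_def card)
    hence "w C - d * s C = w D - d * s D"
      by (simp add: mc_weight_perturb[OF A C] mc_weight_perturb[OF A D] mp_power_def w_def s_def)
    thus False using b(2)[OF d] * by blast
  qed
  thus ?thesis using z b(1) unfolding good_directions_def by blast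
qed

lemma distinct_edge_sums_transpose:
  fixes z :: "real ^ 'n ^ 'n::finite"
  assumes "distinct_edge_sums z"
  shows "distinct_edge_sums (transpose z)"
  unfolding distinct_edge_sums_def
proof (rule injI)
  have conv: "(\<Sum>(i, j)\<in>C. transpose z $ i $ j) = (\<Sum>(i, j)\<in>C\<inverse>. z $ i $ j)" for C :: "'n rel"
    by (rule sum.reindex_bij_witness[of _ prod.swap prod.swap]) (auto simp: transpose_def)
  fix C D :: "'n rel"
  assume "(\<Sum>(i, j)\<in>C. transpose z $ i $ j) = (\<Sum>(i, j)\<in>D. transpose z $ i $ j)"
  hence "C\<inverse> = D\<inverse>" using assms unfolding conv distinct_edge_sums_def by (rule injD[rotated])
  thus "C = D" by (metis converse_converse)
qed

text \<open>Binary expansions are unique, so scaled powers of two serve as entries.\<close>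

lemma exists_distinct_edge_sums:
  "\<exists>z :: real ^ 'n ^ 'n::finite. (\<forall>i j. z $ i $ j \<in> {0..1}) \<and> distinct_edge_sums z"
proof -
  obtain k :: "'n \<times> 'n \<Rightarrow> nat" and N where k: "k ` UNIV = {i. i < N}" "inj k"
    using finite_imp_inj_to_nat_seg[of "UNIV :: ('n \<times> 'n) set"] by auto
  define z :: "real ^ 'n ^ 'n" where "z = (\<chi> i j. 2 ^ k (i, j) / 2 ^ N)"
  have "k e \<le> N" for e using k(1) by (metis mem_Collect_eq less_imp_le rangeI)
  hence "\<forall>i j. z $ i $ j \<in> {0..1}" by (simp add: z_def power_increasing)
  moreover have "distinct_edge_sums z"
    unfolding distinct_edge_sums_def
  proof (rule injI)
    have enc: "(\<Sum>(i, j)\<in>C. z $ i $ j) = real (set_encode (k ` C)) / 2 ^ N" for C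
    proof -
      have "set_encode (k ` C) = (\<Sum>e\<in>C. 2 ^ k e)"
        unfolding set_encode_def using k(2) by (subst sum.reindex) (auto intro: inj_on_subset)
      moreover have "(\<Sum>(i, j)\<in>C. z $ i $ j) = (\<Sum>e\<in>C. 2 ^ k e / 2 ^ N)"
        by (intro sum.cong) (auto simp: z_def)
      ultimately show ?thesis by (simp add: sum_divide_distrib)
    qed
    fix C D :: "'n rel"
    assume "(\<Sum>(i, j)\<in>C. z $ i $ j) = (\<Sum>(i, j)\<in>D. z $ i $ j)"
    hence "set_encode (k ` C) = set_encode (k ` D)" unfolding enc by simp
    hence "k ` C = k ` D" using inj_onD[OF inj_on_set_encode] by simp
    thus "C = D" using k(2) by (simp add: inj_image_eq_iff)
  qed
  ultimately show ?thesis by blast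
qed

section \<open>Orthogonality of algebraic eigenvectors\<close>

text \<open>
  In dimension one the characteristic polynomial is \<open>max t l\<close>, so its value at \<open>-\<infinity>\<close> determines the
  only eigenvalue.
\<close>

lemma algebraic_eigenvalue_dim_1:
  fixes A :: "ereal ^ 'n ^ 'n::finite"
  assumes "algebraic_eigenvalue A l" "CARD('n) = 1"
  shows "mp_charpoly A (-\<infinity>) = l"
proof -
  obtain R p where R: "finite R" "\<forall>s\<in>R. p s \<ge> (1::nat)" "(\<Sum>s\<in>R. p s) = 1" "l \<in> R"
    "\<forall>t\<in>rmax. mp_charpoly A t = (\<Sum>s\<in>R. mp_power (max t s) (p s))"
    using assms unfolding algebraic_eigenvalue_def by auto
  have "p l + (\<Sum>s\<in>R - {l}. p s) = 1" using R by (simp add: sum.remove[of R l])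
  moreover have "p l \<ge> 1" using R by simp
  ultimately have pl: "p l = 1" and "(\<Sum>s\<in>R - {l}. p s) = 0" by linarith+
  hence "\<forall>s\<in>R - {l}. p s = 0" using R(1) by simp
  hence "R = {l}" using R(2,4) by force
  thus ?thesis using R(5) pl by (simp add: rmax_def mp_power_def flip: one_ereal_def)
qed

lemma algebraic_eigenvalue_rmax: "algebraic_eigenvalue A l \<Longrightarrow> l \<in> rmax"
  by (auto simp: algebraic_eigenvalue_def)

lemma mp_ball_nonempty: "r > 0 \<Longrightarrow> l \<in> rmax \<Longrightarrow> mp_ball l r \<noteq> {}"
  by (cases l) (auto simp: mp_ball_def rmax_def)

lemma mp_ball_rmax: "l \<in> rmax \<Longrightarrow> a \<in> mp_ball l r \<Longrightarrow> a \<in> rmax"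
  by (cases l; cases a) (auto simp: mp_ball_def rmax_def)

lemma mp_ball_eventually_disjoint:
  assumes "l \<in> rmax" "m \<in> rmax" "l \<noteq> m" and "c > 0"
  shows "\<forall>\<^sub>F d in at_right 0. mp_ball l (c * d) \<inter> mp_ball m (c * d) = {}"
proof (cases "l = -\<infinity> \<or> m = -\<infinity>")
  case True
  hence "mp_ball l r \<inter> mp_ball m r = {}" for r
    using assms by (cases l; cases m) (auto simp: mp_ball_def rmax_def)
  thus ?thesis by simp
next
  case False
  then obtain l' m' where lm: "l = ereal l'" "m = ereal m'"
    using assms by (cases l; cases m) (auto simp: rmax_def)
  have "mp_ball l (c * d) \<inter> mp_ball m (c * d) = {}" if "0 < d" "d < \<bar>l' - m'\<bar> / (2 * c)" for d
  proof (rule ccontr)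
    assume "\<not> ?thesis"
    then obtain a where a: "a \<in> mp_ball l (c * d)" "a \<in> mp_ball m (c * d)" by blast
    then obtain a' where "a = ereal a'" by (cases a) (auto simp: mp_ball_def lm)
    hence "\<bar>l' - m'\<bar> \<le> 2 * (c * d)" using a by (auto simp: mp_ball_def lm)
    thus False using that \<open>c > 0\<close> by (simp add: field_simps)
  qed
  moreover have "\<bar>l' - m'\<bar> / (2 * c) > 0" using assms lm by simp
  ultimately show ?thesis unfolding eventually_at_right_field by blast
qed

theorem theorem4p1:
  fixes A :: "ereal ^ 'n ^ 'n::finite"
    and l m :: ereal
    and x y :: "ereal ^ 'n"
  assumes "A \<in> rmax_mat"
    and "\<forall>i j. A $ i $ j = A $ j $ i"
    and "algebraic_eigenvalue A l"
    and "algebraic_eigenvalue A m"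
    and "l \<noteq> m"
    and "x \<in> algebraic_eigenspace A l - {mp_zero_vec}"
    and "y \<in> algebraic_eigenspace A m - {mp_zero_vec}"
  shows "mp_orthogonal x y"
proof -
  have "CARD('n) \<noteq> 1"
    using algebraic_eigenvalue_dim_1[OF assms(3)] algebraic_eigenvalue_dim_1[OF assms(4)] assms(5) by auto
  moreover have "CARD('n) > 0" by simp
  ultimately have card: "CARD('n) \<ge> 2" by linarith
  have l: "l \<in> rmax" and m: "m \<in> rmax" using assms(3,4) algebraic_eigenvalue_rmax by auto
  obtain z :: "real ^ 'n ^ 'n" where z: "\<forall>i j. z $ i $ j \<in> {0..1}" "distinct_edge_sums z"
    using exists_distinct_edge_sums by blast
  have zT: "\<forall>i j. transpose z $ i $ j \<in> {0..1}" using z(1) by (simp add: transpose_def)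
  \<comment> \<open>\<open>A\<close> may have no symmetric good direction, but the limits defining the eigenspaces
      may use \<open>z\<close> for \<open>x\<close> and the transpose of \<open>z\<close> for \<open>y\<close>.\<close>
  have good: "z \<in> good_directions A" "transpose z \<in> good_directions A"
    by (rule distinct_edge_sums_good_direction[OF assms(1) z])
      (rule distinct_edge_sums_good_direction[OF assms(1) zT distinct_edge_sums_transpose[OF z(2)]])
  define B where "B d = perturb A z d" for d
  have BT: "perturb A (transpose z) d = transpose (B d)" for d
    using assms(2) by (simp add: B_def perturb_def transpose_def vec_eq_iff)
  have B: "B d \<in> rmax_mat" "transpose (B d) \<in> rmax_mat" for d
    unfolding BT[symmetric] by (simp_all add: B_def perturb_rmax_mat assms(1))
  have ev_star: "\<forall>\<^sub>F d in at_right 0. star_condition (perturb A z' d)" if "z' \<in> good_directions A" for z'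
    using that unfolding good_directions_def eventually_at_right_field by auto
  define U where "U A' k = circuit_space A' k (SOME C. maximal_multi_circuit A' k C)"
    for A' :: "ereal ^ 'n ^ 'n" and k
  define r where "r d = real CARD('n) * d" for d
  have x: "x \<in> mp_lim_set (\<lambda>d. mp_subspace_sum (mp_ball l (r d)) (U (B d)))"
    using assms(6) good(1) unfolding algebraic_eigenspace_def B_def U_def r_def by blast
  have y: "y \<in> mp_lim_set (\<lambda>d. mp_subspace_sum (mp_ball m (r d)) (U (transpose (B d))))"
    using assms(7) good(2) unfolding algebraic_eigenspace_def BT[symmetric] U_def r_def by blast
  obtain f where f: "\<forall>\<^sub>F d in at_right 0. f d \<in> mp_subspace_sum (mp_ball l (r d)) (U (B d))"
      "(f \<longlongrightarrow> x) (at_right 0)" and xr: "x \<in> rmax_vec"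
    using x unfolding mp_lim_set_def by blast
  obtain g where g: "\<forall>\<^sub>F d in at_right 0. g d \<in> mp_subspace_sum (mp_ball m (r d)) (U (transpose (B d)))"
      "(g \<longlongrightarrow> y) (at_right 0)" and yr: "y \<in> rmax_vec"
    using y unfolding mp_lim_set_def by blast
  have disj: "\<forall>\<^sub>F d in at_right 0. mp_ball l (r d) \<inter> mp_ball m (r d) = {}"
    unfolding r_def by (rule mp_ball_eventually_disjoint[OF l m assms(5)]) simp
  have pos: "\<forall>\<^sub>F d in at_right (0::real). 0 < d" by (rule eventually_at_right_less)
  have "\<forall>\<^sub>F d in at_right 0. no_strict_maximum (f d) (g d)"
    using f(1) g(1) disj pos ev_star[OF good(1)] ev_star[OF good(2)]
  proof eventually_elim
    case (elim d)
    have ball: "mp_ball l (r d) \<noteq> {}" "mp_ball m (r d) \<noteq> {}"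
      using elim(4) l m by (simp_all add: mp_ball_nonempty r_def)
    obtain F where F: "f d = (\<chi> i. SUP k\<in>mp_ball l (r d). F k $ i)"
      "\<forall>k\<in>mp_ball l (r d). F k \<in> U (B d) k" "finite {k \<in> mp_ball l (r d). F k \<noteq> mp_zero_vec}"
      using elim(1) unfolding mp_subspace_sum_def by blast
    obtain G where G: "g d = (\<chi> i. SUP k\<in>mp_ball m (r d). G k $ i)"
      "\<forall>k\<in>mp_ball m (r d). G k \<in> U (transpose (B d)) k"
      "finite {k \<in> mp_ball m (r d). G k \<noteq> mp_zero_vec}"
      using elim(2) unfolding mp_subspace_sum_def by blast
    have FG: "no_strict_maximum (F k) (G k')" if k: "k \<in> mp_ball l (r d)" "k' \<in> mp_ball m (r d)" for k k'
    proof (rule no_strict_maximum_circuit_spaces[OF B(1)])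
      show "star_condition (B d)" "star_condition (transpose (B d))"
        using elim(5,6) by (simp_all add: B_def[symmetric] BT)
      show "k \<in> rmax" "k' \<in> rmax" using mp_ball_rmax l m k by blast+
      show "k \<noteq> k'" using elim(3) k by blast
      show "maximal_multi_circuit (B d) k (SOME C. maximal_multi_circuit (B d) k C)"
        using exists_maximal_multi_circuit[OF B(1)] by (rule someI_ex)
      show "maximal_multi_circuit (transpose (B d)) k' (SOME C. maximal_multi_circuit (transpose (B d)) k' C)"
        using exists_maximal_multi_circuit[OF B(2)] by (rule someI_ex)
      show "F k \<in> circuit_space (B d) k (SOME C. maximal_multi_circuit (B d) k C)"
        using F(2) k(1) by (simp add: U_def)
      show "G k' \<in> circuit_space (transpose (B d)) k' (SOME C. maximal_multi_circuit (transpose (B d)) k' C)"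
        using G(2) k(2) by (simp add: U_def)
      show "CARD('n) \<ge> 2" by (rule card)
    qed
    have "no_strict_maximum (f d) (G k')" if "k' \<in> mp_ball m (r d)" for k'
      unfolding F(1) using FG that by (intro no_strict_maximum_SUP ball F(3)) auto
    hence "no_strict_maximum (g d) (f d)"
      unfolding G(1) by (intro no_strict_maximum_SUP ball G(3)) (simp add: no_strict_maximum_commute)
    thus ?case by (simp add: no_strict_maximum_commute)
  qed
  hence "no_strict_maximum x y"
    by (intro no_strict_maximum_limit[OF _ f(2) g(2) _ xr yr]) auto
  thus ?thesis by (rule no_strict_maximum_imp_orthogonal)
qed

end
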